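(* For a traceless local operator $A$ with $\|A\|=1$, let $$f(x):=\frac{\operatorname{tr}(HA)}{\operatorname{tr}(Hh)}\,x .$$ Then the eigenstate thermalization hypothesis in the middle of the spectrum (the assumption stated in the context) implies that $$R_f(N)=O(1/N).$$
   Context: Setting: a chain of $N$ spins with periodic boundary conditions, each spin having local dimension $d_{\mathrm{loc}}=\Theta(1)$, so that the Hilbert space has dimension $d=d_{\mathrm{loc}}^N$. The lattice translation $\mathbb T$ is the unitary with $\mathbb T(|x_1\rangle\otimes|x_2\rangle\otimes\cdots\otimes|x_N\rangle)=|x_2\rangle\otimes\cdots\otimes|x_N\rangle\otimes|x_1\rangle$ on computational basis states. The Hamiltonian is $H=\sum_{l=0}^{N-1}H_l$ with $H_l=\mathbb T^{-l}h\mathbb T^l$, where $h$ is a fixed ($N$-independent) Hermitian operator acting on the first $k=\Theta(1)$ spins, with $\operatorname{tr}h=0$ and $\|h\|=1$ (operator norm). Only sufficiently large $N$ are considered; for such $N$, $\operatorname{tr}(HA)/d$ and $\operatorname{tr}(Hh)/d$ are $N$-independent, so $f$ is $N$-independent. Eigenstates: $\{|j\rangle\}_{j=1}^d$ is a complete set of translation-invariant eigenstates of $H$ (simultaneous eigenstates of $H$ and $\mathbb T$) with corresponding energies $E_j$. Both depend on $N$. A local operator is a fixed operator whose support is contained in a consecutive region of $\Theta(1)$ spins (tensored with the identity on the remaining spins). Convergence rate: for a traceless local operator $A$ with $\|A\|=1$, let $f:[-1,1]\to\{z\in\mathbb C:|z|\le1\}$ be an $N$-independent function, smooth in the sense of having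 a Taylor expansion to second order around $x=0$, $f(x)=f(0)+f'(0)x+f''(0)x^2/2+O(x^3)$. Define $$r_f(N)=\sqrt{\frac1d\sum_j\big|\langle j|A|j\rangle-f(E_j/N)\big|^2},\qquad R_f(N)=\sup_{n\ge N}r_f(n).$$ Assumption (eigenstate thermalization hypothesis in the middle of the spectrum): Let $\epsilon$ be an arbitrarily small positive constant. For any traceless local operator $A$ with $\|A\|=1$, there is a sequence of functions $g_N:[-\epsilon,\epsilon]\to\{z\in\mathbb C:|z|\le1\}$ (one for each system size $N$) such that $$\big|\langle j|A|j\rangle-g_N(E_j/N)\big|\le 1/\mathrm{poly}(N)$$ for all $j$ with $|E_j|\le N\epsilon$, where $\mathrm{poly}(N)$ denotes a polynomial of sufficiently high degree in $N$. Each $g_N(x)$ is assumed smooth in the sense of having a Taylor expansion to some low order around $x=0$. *)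

theory Defs
  imports
    "Jordan_Normal_Form.Schur_Decomposition"
    "HOL-Computational_Algebra.Polynomial"
    "HOL-Library.Landau_Symbols"
    Complex_Main
begin

section \<open>Trace, norms and expectation values\<close>

definition mat_trace :: "complex mat \<Rightarrow> complex" where
  "mat_trace A = (\<Sum>i < dim_row A. A $$ (i, i))"

definition vnorm :: "complex vec \<Rightarrow> real" where
  "vnorm v = sqrt (Re (v \<bullet>c v))"

definition op_norm :: "complex mat \<Rightarrow> real" where
  "op_norm A = (SUP v \<in> {v \<in> carrier_vec (dim_col A). vnorm v = 1}. vnorm (A *\<^sub>v v))"

definition expval :: "complex mat \<Rightarrow> complex vec \<Rightarrow> complex" where
  "expval A v = (A *\<^sub>v v) \<bullet>c v"

section \<open>The periodic chain\<close>

text \<open>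
  A chain of \<open>N\<close> spins of local dimension \<open>q\<close> has the state space of complex vectors of
  dimension \<open>q ^ N\<close>.  The computational basis state with local labels \<open>x\<^sub>1, \<dots>, x\<^sub>N < q\<close> is the
  unit vector whose index has the base-\<open>q\<close> digits \<open>x\<^sub>1 \<dots> x\<^sub>N\<close>, the first spin being the most
  significant digit.  In particular \<open>i div q ^ (N - k)\<close> encodes the labels of the first \<open>k\<close>
  spins of \<open>i\<close>, and \<open>i mod q ^ (N - k)\<close> those of the remaining ones.
\<close>

text \<open>
  The lattice translation: the column of \<open>x\<^sub>1 x\<^sub>2 \<dots> x\<^sub>N\<close> has its only nonzero entry in the row
  of \<open>x\<^sub>2 \<dots> x\<^sub>N x\<^sub>1\<close>.
\<close>

definition translation :: "nat \<Rightarrow> nat \<Rightarrow> complex mat" where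
  "translation q N = mat (q ^ N) (q ^ N)
     (\<lambda>(i, j). if i = (j mod q ^ (N - 1)) * q + j div q ^ (N - 1) then 1 else 0)"

text \<open>The operator \<open>a\<close> on the first \<open>k\<close> spins, tensored with the identity on the others
  (meaningful for \<open>k \<le> N\<close>).\<close>

definition on_first :: "nat \<Rightarrow> nat \<Rightarrow> nat \<Rightarrow> complex mat \<Rightarrow> complex mat" where
  "on_first q N k a = mat (q ^ N) (q ^ N)
     (\<lambda>(i, j). if i mod q ^ (N - k) = j mod q ^ (N - k)
               then a $$ (i div q ^ (N - k), j div q ^ (N - k)) else 0)"

text \<open>The operator \<open>a\<close> on the \<open>k\<close> consecutive spins \<open>s + 1, \<dots>, s + k\<close>.  The translation is
  unitary (shown below), so its inverse powers are written as adjoints.\<close>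

definition on_sites :: "nat \<Rightarrow> nat \<Rightarrow> nat \<Rightarrow> nat \<Rightarrow> complex mat \<Rightarrow> complex mat" where
  "on_sites q N s k a =
     mat_adjoint (translation q N ^\<^sub>m s) * on_first q N k a * translation q N ^\<^sub>m s"

text \<open>The sum is taken entrywise because matrices of unspecified dimension have no zero.\<close>

definition hamiltonian :: "nat \<Rightarrow> nat \<Rightarrow> nat \<Rightarrow> complex mat \<Rightarrow> complex mat" where
  "hamiltonian q N k h = mat (q ^ N) (q ^ N) (\<lambda>ij. \<Sum>l<N. on_sites q N l k h $$ ij)"

definition traceless_unit :: "nat \<Rightarrow> nat \<Rightarrow> complex mat \<Rightarrow> bool" where
  "traceless_unit q k a \<longleftrightarrow>
     a \<in> carrier_mat (q ^ k) (q ^ k) \<and> mat_trace a = 0 \<and> op_norm a = 1"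

text \<open>\<open>d = q ^ N\<close> orthonormal simultaneous eigenvectors of \<open>H\<close> and of the translation.\<close>

definition ti_eigenbasis ::
  "nat \<Rightarrow> nat \<Rightarrow> complex mat \<Rightarrow> (nat \<Rightarrow> complex vec) \<Rightarrow> (nat \<Rightarrow> real) \<Rightarrow> bool" where
  "ti_eigenbasis q N H \<psi> E \<longleftrightarrow>
     (\<forall>j < q ^ N. \<psi> j \<in> carrier_vec (q ^ N)) \<and>
     (\<forall>i < q ^ N. \<forall>j < q ^ N. \<psi> i \<bullet>c \<psi> j = (if i = j then 1 else 0)) \<and>
     (\<forall>j < q ^ N. H *\<^sub>v \<psi> j = complex_of_real (E j) \<cdot>\<^sub>v \<psi> j) \<and>
     (\<forall>j < q ^ N. \<exists>\<theta>. translation q N *\<^sub>v \<psi> j = \<theta> \<cdot>\<^sub>v \<psi> j)"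

section \<open>Eigenstate thermalization in the middle of the spectrum\<close>

text \<open>
  The families \<open>\<psi> N j\<close>, \<open>E N j\<close> are the eigenstates and energies for system size \<open>N\<close>; the local
  operator is \<open>a\<close> acting on the spins \<open>s + 1, \<dots>, s + l\<close>.  The
  error is \<open>1 / P N\<close> for a polynomial \<open>P\<close> of degree at least \<open>p\<close>.  The
  functions \<open>g N\<close> have a Taylor expansion at \<open>0\<close> to some order \<open>m \<ge> 1\<close> with
  coefficients \<open>c N i\<close>; the constants \<open>K\<close> and \<open>\<delta>\<close> in its remainder do not
  depend on \<open>N\<close>.
\<close>

definition eth_middle ::
  "nat \<Rightarrow> real \<Rightarrow> nat \<Rightarrow> (nat \<Rightarrow> nat \<Rightarrow> complex vec) \<Rightarrow> (nat \<Rightarrow> nat \<Rightarrow> real) \<Rightarrow> bool" where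
  "eth_middle p \<epsilon> q \<psi> E \<longleftrightarrow>
     (\<forall>s l a. traceless_unit q l a \<longrightarrow>
       (\<exists>(g :: nat \<Rightarrow> real \<Rightarrow> complex) (P :: real poly) (m :: nat) (c :: nat \<Rightarrow> nat \<Rightarrow> complex)
          (K :: real) (\<delta> :: real).
          degree P \<ge> p \<and> lead_coeff P > 0 \<and> m \<ge> 1 \<and> 0 < \<delta> \<and> \<delta> \<le> \<epsilon> \<and>
          (\<forall>\<^sub>F N in sequentially.
             (\<forall>x \<in> {-\<epsilon>..\<epsilon>}. cmod (g N x) \<le> 1) \<and>
             (\<forall>x \<in> {-\<delta>..\<delta>}.
                cmod (g N x - (\<Sum>i\<le>m. c N i * of_real x ^ i)) \<le> K * \<bar>x\<bar> ^ (m + 1)) \<and>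
             (\<forall>j < q ^ N. \<bar>E N j\<bar> \<le> real N * \<epsilon> \<longrightarrow>
                cmod (expval (on_sites q N s l a) (\<psi> N j) - g N (E N j / real N))
                  \<le> 1 / poly P (real N)))))"

section \<open>Rate of convergence\<close>

definition conv_rate ::
  "nat \<Rightarrow> (nat \<Rightarrow> nat \<Rightarrow> complex vec) \<Rightarrow> (nat \<Rightarrow> nat \<Rightarrow> real) \<Rightarrow> (nat \<Rightarrow> complex mat)
     \<Rightarrow> (real \<Rightarrow> complex) \<Rightarrow> nat \<Rightarrow> real" where
  "conv_rate q \<psi> E A f N =
     sqrt ((\<Sum>j < q ^ N. (cmod (expval (A N) (\<psi> N j) - f (E N j / real N)))\<^sup>2) / real (q ^ N))"

definition sup_conv_rate ::
  "nat \<Rightarrow> (nat \<Rightarrow> nat \<Rightarrow> complex vec) \<Rightarrow> (nat \<Rightarrow> nat \<Rightarrow> real) \<Rightarrow> (nat \<Rightarrow> complex mat)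
     \<Rightarrow> (real \<Rightarrow> complex) \<Rightarrow> nat \<Rightarrow> real" where
  "sup_conv_rate q \<psi> E A f N = (SUP n \<in> {N..}. conv_rate q \<psi> E A f n)"

section \<open>The translation is unitary\<close>

lemma translation_index_inj:
  fixes q r i j :: nat
  assumes "i < q * r" "j < q * r"
    and "(i mod r) * q + i div r = (j mod r) * q + j div r"
  shows "i = j"
proof -
  have q: "0 < q" using assms(1) by (cases q) auto
  have b: "i div r < q" "j div r < q"
    using assms(1,2) by (simp_all add: less_mult_imp_div_less)
  have "((i mod r) * q + i div r) div q = ((j mod r) * q + j div r) div q"
       "((i mod r) * q + i div r) mod q = ((j mod r) * q + j div r) mod q"
    using assms(3) by simp_all
  then have "i mod r = j mod r" "i div r = j div r" using b q by simp_all
  then show ?thesis by (metis div_mult_mod_eq)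
qed

lemma translation_unitary:
  assumes "0 < N"
  shows "mat_adjoint (translation q N) * translation q N = 1\<^sub>m (q ^ N)"
proof (rule eq_matI)
  let ?r = "q ^ (N - 1)"
  let ?t = "\<lambda>j. (j mod ?r) * q + j div ?r"
  have qN: "q ^ N = q * ?r" using assms by (cases N) auto
  have bnd: "?t j < q ^ N" if "j < q ^ N" for j
  proof -
    have r: "0 < ?r" using that qN by (cases "?r") auto
    have "j div ?r < q" using that qN by (simp add: less_mult_imp_div_less)
    then have "?t j < (j mod ?r + 1) * q" by simp
    also have "\<dots> \<le> ?r * q" using r by (intro mult_right_mono) (auto simp: Suc_le_eq)
    finally show ?thesis using qN by (simp add: mult.commute)
  qed
  fix i j assume "i < dim_row (1\<^sub>m (q ^ N) :: complex mat)" "j < dim_col (1\<^sub>m (q ^ N) :: complex mat)"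
  then have ij: "i < q ^ N" "j < q ^ N" by auto
  have "(mat_adjoint (translation q N) * translation q N) $$ (i, j)
      = (\<Sum>k \<in> {0..<q ^ N}. (if k = ?t i then 1 else 0) * (if k = ?t j then 1 else 0))"
    using ij by (auto simp: mat_adjoint_def translation_def scalar_prod_def mat_of_rows_def
        intro!: sum.cong)
  also have "\<dots> = (\<Sum>k \<in> {0..<q ^ N}. if k = ?t i then (if ?t i = ?t j then 1 else 0) else 0)"
    by (intro sum.cong) auto
  also have "\<dots> = (if ?t i = ?t j then 1 else 0)"
    using bnd[OF ij(1)] by simp
  also have "\<dots> = (if i = j then 1 else 0)"
    using translation_index_inj[of i q ?r j] ij qN by auto
  finally show "(mat_adjoint (translation q N) * translation q N) $$ (i, j) = 1\<^sub>m (q ^ N) $$ (i, j)"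
    using ij by simp
qed (auto simp: mat_adjoint_def translation_def)

end

theory Submission
  imports Defs
begin

text \<open>
  Put \<open>x\<^sub>j = E\<^sub>j / N\<close>, \<open>A\<^sub>j = \<langle>j|A|j\<rangle>\<close> and \<open>c = tr (HA) / tr (Hh)\<close>.  As \<open>tr H = tr A = 0\<close> and
  \<open>tr (H\<^sup>2) = N tr (Hh)\<close>, the function \<open>c x\<close> is the least-squares approximation of \<open>A\<^sub>j\<close> by affine
  functions of \<open>x\<^sub>j\<close>, so in bounding its error it may be replaced by the first-order Taylor polynomial of \<open>g\<^sub>N\<close>.
  The latter has error at most \<open>K x\<^sub>j\<^sup>2 + 1 / N\<close> for every \<open>j\<close>: by thermalization if \<open>x\<^sub>j\<close> is small,
  trivially if \<open>x\<^sub>j\<close> is bounded away from \<open>0\<close>.  It remains to bound the mean of \<open>x\<^sub>j\<^sup>4\<close> by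
  \<open>O(1 / N\<^sup>2)\<close>, that is \<open>tr (H\<^sup>4) / d\<close> by \<open>O(N\<^sup>2)\<close>; this holds because the trace of a product of four
  local terms vanishes when one of them is supported away from the others.
\<close>

section \<open>Traces and expectation values\<close>

text \<open>The obstacle is uniformity in \<open>N\<close>. The functions \<open>g N\<close> vary
  with the system size, and the assumption bounds none of their Taylor coefficients; only the order
  \<open>m\<close> and the constants \<open>K\<close> and \<open>\<delta>\<close> are shared by all
  \<open>N\<close>. The bound \<open>cmod (g N x) \<le> 1\<close> supplies what is missing: it keeps
  the Taylor polynomials bounded on a fixed interval, and for polynomials of fixed degree this
  bounds every coefficient. The affine approximations obtained in this way still depend on
  \<open>N\<close>, but optimality of the slope c removes them from the final estimate. The orders
  match as follows. The fourth moment shows that x_j has typical size at most N^(-1/2), so a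
  quadratic error is of order 1/N, the claimed rate. The linear term alone would be of order
  N^(-1/2), hence it has to be captured exactly. The slope must itself be the same for all large
  \<open>N\<close>. This holds because only boundedly many terms of H overlap a given local
  operator, and their contributions can be computed on a chain of fixed length.\<close>

lemma mat_mult_index:
  assumes "A \<in> carrier_mat n m" "B \<in> carrier_mat m p" "i < n" "j < p"
  shows "(A * B) $$ (i, j) = (\<Sum>l<m. A $$ (i, l) * B $$ (l, j))"
  using assms by (simp add: scalar_prod_def atLeast0LessThan)

lemma mat_trace_mult:
  assumes "A \<in> carrier_mat n m" "B \<in> carrier_mat m n"
  shows "mat_trace (A * B) = (\<Sum>i<n. \<Sum>j<m. A $$ (i, j) * B $$ (j, i))"
  using assms by (auto simp: mat_trace_def scalar_prod_def atLeast0LessThan intro!: sum.cong)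

lemma mat_trace_cyclic:
  assumes "A \<in> carrier_mat n m" "B \<in> carrier_mat m n"
  shows "mat_trace (A * B) = mat_trace (B * A)"
  unfolding mat_trace_mult[OF assms] mat_trace_mult[OF assms(2,1)]
  by (subst sum.swap) (simp add: mult.commute)

lemma expval_eq_sum:
  assumes "A \<in> carrier_mat n n" "v \<in> carrier_vec n"
  shows "expval A v = (\<Sum>i<n. \<Sum>j<n. A $$ (i, j) * v $ j * cnj (v $ i))"
  using assms
  by (auto simp: expval_def scalar_prod_def atLeast0LessThan sum_distrib_right intro!: sum.cong)

text \<open>With the vectors as columns of \<open>U\<close> and \<open>V\<close> the adjoint of
  \<open>U\<close>, the sum is the trace of \<open>V * (A * U)\<close>. Orthonormality gives
  \<open>V * U = 1\<close>, and for square matrices a left inverse is a right inverse, so cyclicity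
  leaves the trace of \<open>A\<close>.\<close>

lemma sum_expval_orthonormal:
  assumes A: "A \<in> carrier_mat n n" and \<psi>: "\<And>j. j < n \<Longrightarrow> \<psi> j \<in> carrier_vec n"
    and on: "\<And>i j. i < n \<Longrightarrow> j < n \<Longrightarrow> \<psi> i \<bullet>c \<psi> j = (if i = j then 1 else 0)"
  shows "(\<Sum>j<n. expval A (\<psi> j)) = mat_trace A"
proof -
  define U where "U = mat n n (\<lambda>(i, j). \<psi> j $ i)"
  define V where "V = mat n n (\<lambda>(i, j). cnj (\<psi> i $ j))"
  have U: "U \<in> carrier_mat n n" and V: "V \<in> carrier_mat n n" by (auto simp: U_def V_def)
  have "V * U = 1\<^sub>m n"
  proof (rule eq_matI)
    fix i j assume ij: "i < dim_row (1\<^sub>m n :: complex mat)" "j < dim_col (1\<^sub>m n :: complex mat)"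
    then have "(V * U) $$ (i, j) = \<psi> j \<bullet>c \<psi> i"
      using \<psi>[of i] \<psi>[of j] by (auto simp: U_def V_def scalar_prod_def mult.commute)
    with on[of j i] ij show "(V * U) $$ (i, j) = 1\<^sub>m n $$ (i, j)" by auto
  qed (auto simp: U_def V_def)
  then have UV: "U * V = 1\<^sub>m n" using mat_mult_left_right_inverse[OF V U] by simp
  have "(\<Sum>j<n. expval A (\<psi> j)) = mat_trace (V * (A * U))"
    using A \<psi> unfolding mat_trace_mult[OF V mult_carrier_mat[OF A U]]
    by (auto simp: expval_eq_sum U_def V_def scalar_prod_def atLeast0LessThan sum_distrib_left
        mult.commute mult.left_commute intro!: sum.cong)
  also have "\<dots> = mat_trace (A * (U * V))"
    using mat_trace_cyclic[OF V mult_carrier_mat[OF A U]] assoc_mult_mat[OF A U V] by simp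
  finally show ?thesis using A UV by simp
qed

lemma expval_mult_eigenvector:
  assumes "A \<in> carrier_mat n n" "H \<in> carrier_mat n n" "v \<in> carrier_vec n"
    and "H *\<^sub>v v = e \<cdot>\<^sub>v v"
  shows "expval (A * H) v = e * expval A v"
  using assms by (simp add: expval_def assoc_mult_mat_vec mult_mat_vec)

text \<open>A substitute for the operator norm that is checked entry by entry: it is
  submultiplicative, survives tensoring with an identity and relabelling of the basis with the same
  constant, and bounds traces and expectation values. A bound for the fixed matrix \<open>h\<close>
  or \<open>a\<close> therefore holds on chains of every length. Rows and columns both enter the
  Schur test.\<close>

definition abs_sums_le :: "complex mat \<Rightarrow> real \<Rightarrow> bool" where
  "abs_sums_le A C \<longleftrightarrow>
     (\<forall>i < dim_row A. (\<Sum>j<dim_col A. cmod (A $$ (i, j))) \<le> C) \<and>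
     (\<forall>j < dim_col A. (\<Sum>i<dim_row A. cmod (A $$ (i, j))) \<le> C)"

lemma abs_sums_le_row: "abs_sums_le A C \<Longrightarrow> A \<in> carrier_mat n m \<Longrightarrow> i < n \<Longrightarrow>
    (\<Sum>j<m. cmod (A $$ (i, j))) \<le> C"
  and abs_sums_le_col: "abs_sums_le A C \<Longrightarrow> A \<in> carrier_mat n m \<Longrightarrow> j < m \<Longrightarrow>
    (\<Sum>i<n. cmod (A $$ (i, j))) \<le> C"
  by (auto simp: abs_sums_le_def)

lemma abs_sums_le_exists:
  obtains C where "C \<ge> 0" "abs_sums_le A C"
proof
  let ?C = "\<Sum>i<dim_row A. \<Sum>j<dim_col A. cmod (A $$ (i, j))"
  show "?C \<ge> 0" by (intro sum_nonneg) auto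
  have "(\<Sum>j<dim_col A. cmod (A $$ (i, j))) \<le> ?C" if "i < dim_row A" for i
    using that by (intro member_le_sum[where f = "\<lambda>i. \<Sum>j<dim_col A. cmod (A $$ (i, j))"])
      (auto intro: sum_nonneg)
  moreover have "(\<Sum>i<dim_row A. cmod (A $$ (i, j))) \<le> ?C" if "j < dim_col A" for j
    using that by (intro sum_mono member_le_sum) auto
  ultimately show "abs_sums_le A ?C" by (auto simp: abs_sums_le_def)
qed

lemma abs_sums_le_mult:
  assumes A: "A \<in> carrier_mat n m" and B: "B \<in> carrier_mat m p"
    and "abs_sums_le A C" "abs_sums_le B D" "0 \<le> C" "0 \<le> D"
  shows "abs_sums_le (A * B) (C * D)"
proof -
  have entry: "cmod ((A * B) $$ (i, j)) \<le> (\<Sum>l<m. cmod (A $$ (i, l)) * cmod (B $$ (l, j)))"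
    if "i < n" "j < p" for i j
    using that A B
    by (auto simp: scalar_prod_def atLeast0LessThan norm_mult[symmetric] intro!: norm_sum)
  have "(\<Sum>j<p. cmod ((A * B) $$ (i, j))) \<le> C * D" if i: "i < n" for i
  proof -
    have "(\<Sum>j<p. cmod ((A * B) $$ (i, j)))
        \<le> (\<Sum>j<p. \<Sum>l<m. cmod (A $$ (i, l)) * cmod (B $$ (l, j)))"
      using i by (intro sum_mono entry) auto
    also have "\<dots> = (\<Sum>l<m. cmod (A $$ (i, l)) * (\<Sum>j<p. cmod (B $$ (l, j))))"
      by (subst sum.swap) (simp add: sum_distrib_left)
    also have "\<dots> \<le> (\<Sum>l<m. cmod (A $$ (i, l)) * D)"
      using abs_sums_le_row[OF assms(4) B] by (intro sum_mono mult_left_mono) auto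
    also have "\<dots> \<le> C * D"
      using abs_sums_le_row[OF assms(3) A i] assms(6)
      by (simp add: sum_distrib_right[symmetric] mult_right_mono)
    finally show ?thesis .
  qed
  moreover have "(\<Sum>i<n. cmod ((A * B) $$ (i, j))) \<le> C * D" if j: "j < p" for j
  proof -
    have "(\<Sum>i<n. cmod ((A * B) $$ (i, j)))
        \<le> (\<Sum>i<n. \<Sum>l<m. cmod (A $$ (i, l)) * cmod (B $$ (l, j)))"
      using j by (intro sum_mono entry) auto
    also have "\<dots> = (\<Sum>l<m. (\<Sum>i<n. cmod (A $$ (i, l))) * cmod (B $$ (l, j)))"
      by (subst sum.swap) (simp add: sum_distrib_right)
    also have "\<dots> \<le> (\<Sum>l<m. C * cmod (B $$ (l, j)))"
      using abs_sums_le_col[OF assms(3) A] by (intro sum_mono mult_right_mono) auto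
    also have "\<dots> \<le> C * D"
      using abs_sums_le_col[OF assms(4) B j] assms(5)
      by (simp add: sum_distrib_left[symmetric] mult_left_mono)
    finally show ?thesis .
  qed
  ultimately show ?thesis using A B by (auto simp: abs_sums_le_def)
qed

lemma norm_mat_trace_le:
  assumes A: "A \<in> carrier_mat n n" and C: "abs_sums_le A C"
  shows "cmod (mat_trace A) \<le> C * real n"
proof -
  have "cmod (A $$ (i, i)) \<le> C" if "i < n" for i
  proof -
    have "cmod (A $$ (i, i)) \<le> (\<Sum>j<n. cmod (A $$ (i, j)))"
      using that by (intro member_le_sum) auto
    then show ?thesis using abs_sums_le_row[OF C A that] by simp
  qed
  then have "(\<Sum>i<n. cmod (A $$ (i, i))) \<le> (\<Sum>i<n. C)" by (intro sum_mono) auto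
  moreover have "cmod (mat_trace A) \<le> (\<Sum>i<n. cmod (A $$ (i, i)))"
    using A by (auto simp: mat_trace_def intro: norm_sum)
  ultimately show ?thesis by (simp add: mult.commute)
qed

text \<open>The Schur test: each term is split by \<open>2xy \<le> x\<^sup>2 + y\<^sup>2\<close>.\<close>

lemma norm_expval_le:
  assumes A: "A \<in> carrier_mat n n" and C: "abs_sums_le A C" and v: "v \<in> carrier_vec n"
    and "v \<bullet>c v = 1"
  shows "cmod (expval A v) \<le> C"
proof -
  let ?c = "\<lambda>i. (cmod (v $ i))\<^sup>2 / 2"
  have "v \<bullet>c v = of_real (\<Sum>i<n. (cmod (v $ i))\<^sup>2)"
    using v by (auto simp: scalar_prod_def atLeast0LessThan complex_norm_square
        simp del: of_real_power intro!: sum.cong)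
  then have 1: "(\<Sum>i<n. (cmod (v $ i))\<^sup>2) = 1" using assms(4) by (metis of_real_eq_1_iff)
  have split: "cmod (A $$ (i, j) * v $ j * cnj (v $ i)) \<le> cmod (A $$ (i, j)) * ?c j + cmod (A $$ (i, j)) * ?c i"
    for i j
  proof -
    have "cmod (v $ j) * cmod (v $ i) \<le> ?c j + ?c i"
      using sum_squares_bound[of "cmod (v $ j)" "cmod (v $ i)"] by simp
    from mult_left_mono[OF this norm_ge_zero[of "A $$ (i, j)"]] show ?thesis
      by (simp add: norm_mult distrib_left mult.assoc)
  qed
  have "cmod (expval A v) \<le> (\<Sum>i<n. cmod (\<Sum>j<n. A $$ (i, j) * v $ j * cnj (v $ i)))"
    unfolding expval_eq_sum[OF A v] by (rule norm_sum)
  also have "\<dots> \<le> (\<Sum>i<n. \<Sum>j<n. cmod (A $$ (i, j)) * ?c j + cmod (A $$ (i, j)) * ?c i)"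
    by (intro sum_mono sum_norm_le split)
  also have "\<dots> = (\<Sum>i<n. \<Sum>j<n. cmod (A $$ (i, j)) * ?c j) + (\<Sum>i<n. \<Sum>j<n. cmod (A $$ (i, j)) * ?c i)"
    by (simp only: sum.distrib)
  also have "(\<Sum>i<n. \<Sum>j<n. cmod (A $$ (i, j)) * ?c j) = (\<Sum>j<n. (\<Sum>i<n. cmod (A $$ (i, j))) * ?c j)"
    by (subst sum.swap) (simp only: sum_distrib_right)
  also have "(\<Sum>i<n. \<Sum>j<n. cmod (A $$ (i, j)) * ?c i) = (\<Sum>i<n. (\<Sum>j<n. cmod (A $$ (i, j))) * ?c i)"
    by (simp only: sum_distrib_right)
  also have "(\<Sum>j<n. (\<Sum>i<n. cmod (A $$ (i, j))) * ?c j) + (\<Sum>i<n. (\<Sum>j<n. cmod (A $$ (i, j))) * ?c i)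
      \<le> (\<Sum>j<n. C * ?c j) + (\<Sum>i<n. C * ?c i)"
    using abs_sums_le_row[OF C A] abs_sums_le_col[OF C A]
    by (intro add_mono sum_mono mult_right_mono) auto
  also have "\<dots> = C * (\<Sum>i<n. (cmod (v $ i))\<^sup>2)"
    by (simp add: sum_distrib_left[symmetric] sum_divide_distrib[symmetric])
  finally show ?thesis using 1 by simp
qed

section \<open>Kronecker products\<close>

text \<open>The first factor carries the most significant digits, in agreement with
  \<open>on_first\<close>.\<close>

definition kron :: "complex mat \<Rightarrow> complex mat \<Rightarrow> complex mat" where
  "kron A B = mat (dim_row A * dim_row B) (dim_col A * dim_col B)
     (\<lambda>(i, j). A $$ (i div dim_row B, j div dim_col B) * B $$ (i mod dim_row B, j mod dim_col B))"

lemma kron_carrier [simp]: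
  "A \<in> carrier_mat m n \<Longrightarrow> B \<in> carrier_mat r s \<Longrightarrow> kron A B \<in> carrier_mat (m * r) (n * s)"
  by (auto simp: kron_def)

lemma mod_less_of_less_mult: "i < m * n \<Longrightarrow> i mod n < (n::nat)"
  by (cases n) auto

lemma kron_index:
  assumes "A \<in> carrier_mat m m" "B \<in> carrier_mat n n" "i < m * n" "j < m * n"
  shows "kron A B $$ (i, j) = A $$ (i div n, j div n) * B $$ (i mod n, j mod n)"
  using assms by (auto simp: kron_def)

lemma sum_div_mod:
  fixes F :: "nat \<Rightarrow> nat \<Rightarrow> 'a :: comm_monoid_add"
  shows "(\<Sum>i<m * n. F (i div n) (i mod n)) = (\<Sum>u<m. \<Sum>v<n. F u v)"
proof -
  have "(\<Sum>i<m * n. F (i div n) (i mod n)) = (\<Sum>(u, v)\<in>{..<m} \<times> {..<n}. F u v)"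
  proof (rule sum.reindex_bij_witness[where i = "\<lambda>(u, v). u * n + v"
        and j = "\<lambda>i. (i div n, i mod n)"])
    fix uv assume "uv \<in> {..<m} \<times> {..<n}"
    then obtain u v where uv: "uv = (u, v)" "u < m" "v < n" by auto
    have "u * n + v < (u + 1) * n" using uv by simp
    also have "\<dots> \<le> m * n" using uv by (intro mult_right_mono) auto
    finally show "(case uv of (u, v) \<Rightarrow> u * n + v) \<in> {..<m * n}" using uv by simp
    show "((case uv of (u, v) \<Rightarrow> u * n + v) div n, (case uv of (u, v) \<Rightarrow> u * n + v) mod n) = uv"
      using uv by simp
  qed (auto simp: less_mult_imp_div_less mod_less_of_less_mult)
  then show ?thesis by (simp add: sum.cartesian_product)
qed

lemma kron_assoc:
  assumes A: "A \<in> carrier_mat a a" and B: "B \<in> carrier_mat b b" and C: "C \<in> carrier_mat c c"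
  shows "kron (kron A B) C = kron A (kron B C)"
proof (rule eq_matI)
  fix i j assume "i < dim_row (kron A (kron B C))" "j < dim_col (kron A (kron B C))"
  then have ij: "i < a * b * c" "j < a * b * c"
    using assms by (auto simp: kron_def mult.assoc)
  then have bc: "b * c > 0" by (cases "b * c") (auto simp: mult.assoc)
  have m: "i mod (b * c) < b * c" "j mod (b * c) < b * c" using bc by auto
  have d: "i div c < a * b" "j div c < a * b" using ij by (auto simp: less_mult_imp_div_less)
  \<comment> \<open>The three digits of \<open>x\<close> in mixed radix \<open>a\<close>,
    \<open>b\<close>, \<open>c\<close>, read off under either grouping.\<close>
  have r: "x div c div b = x div (b * c)" "(x div c) mod b = x mod (b * c) div c"
    "x mod c = x mod (b * c) mod c" for x
    using bc by (auto simp: div_mult2_eq mult.commute[of b] mod_mult2_eq)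
  show "kron (kron A B) C $$ (i, j) = kron A (kron B C) $$ (i, j)"
    unfolding kron_index[OF kron_carrier[OF A B] C ij] kron_index[OF A B d]
      kron_index[OF A kron_carrier[OF B C] ij[unfolded mult.assoc]] kron_index[OF B C m]
    by (simp only: r(1-2) r(3)[of i] r(3)[of j] mult.assoc)
qed (use assms in \<open>auto simp: kron_def\<close>)

lemma kron_mult:
  assumes A: "A \<in> carrier_mat m m" and B: "B \<in> carrier_mat n n"
    and C: "C \<in> carrier_mat m m" and D: "D \<in> carrier_mat n n"
  shows "kron A B * kron C D = kron (A * C) (B * D)"
proof (rule eq_matI)
  fix i j assume "i < dim_row (kron (A * C) (B * D))" "j < dim_col (kron (A * C) (B * D))"
  then have ij: "i < m * n" "j < m * n" using assms by (auto simp: kron_def)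
  then have n: "n > 0" by (cases n) auto
  have "(kron A B * kron C D) $$ (i, j) = (\<Sum>l<m * n. kron A B $$ (i, l) * kron C D $$ (l, j))"
    using ij kron_carrier[OF A B] kron_carrier[OF C D]
    by (auto simp: scalar_prod_def atLeast0LessThan)
  also have "\<dots> = (\<Sum>l<m * n. (A $$ (i div n, l div n) * C $$ (l div n, j div n))
      * (B $$ (i mod n, l mod n) * D $$ (l mod n, j mod n)))"
    using ij by (intro sum.cong) (auto simp: kron_index[OF A B] kron_index[OF C D])
  also have "\<dots> = (A * C) $$ (i div n, j div n) * (B * D) $$ (i mod n, j mod n)"
    using ij n assms sum_div_mod[of "\<lambda>u v. (A $$ (i div n, u) * C $$ (u, j div n))
      * (B $$ (i mod n, v) * D $$ (v, j mod n))" n m]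
    by (auto simp: scalar_prod_def atLeast0LessThan less_mult_imp_div_less sum_product)
  finally show "(kron A B * kron C D) $$ (i, j) = kron (A * C) (B * D) $$ (i, j)"
    using kron_index[OF mult_carrier_mat[OF A C] mult_carrier_mat[OF B D] ij] by simp
qed (use assms in \<open>auto simp: kron_def\<close>)

lemma mat_trace_kron:
  assumes A: "A \<in> carrier_mat m m" and B: "B \<in> carrier_mat n n"
  shows "mat_trace (kron A B) = mat_trace A * mat_trace B"
proof -
  have "mat_trace (kron A B) = (\<Sum>i<m * n. A $$ (i div n, i div n) * B $$ (i mod n, i mod n))"
    using kron_carrier[OF A B] by (auto simp: mat_trace_def kron_index[OF A B] intro!: sum.cong)
  then show ?thesis
    using A B sum_div_mod[of "\<lambda>u v. A $$ (u, u) * B $$ (v, v)" n m]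
    by (simp add: mat_trace_def sum_product)
qed

lemma mat_trace_one [simp]: "mat_trace (1\<^sub>m n) = of_nat n"
  by (simp add: mat_trace_def)

lemma kron_one: "kron (1\<^sub>m m) (1\<^sub>m n) = 1\<^sub>m (m * n)"
proof (rule eq_matI)
  fix i j assume "i < dim_row (1\<^sub>m (m * n) :: complex mat)" "j < dim_col (1\<^sub>m (m * n) :: complex mat)"
  then have ij: "i < m * n" "j < m * n" by auto
  then have "i div n < m" "j div n < m" "i mod n < n" "j mod n < n"
    by (auto simp: less_mult_imp_div_less mod_less_of_less_mult)
  moreover have "i div n = j div n \<and> i mod n = j mod n \<longleftrightarrow> i = j"
    by (metis div_mult_mod_eq)
  ultimately show "kron (1\<^sub>m m) (1\<^sub>m n) $$ (i, j) = 1\<^sub>m (m * n) $$ (i, j)"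
    using ij by (auto simp: kron_index[of _ m _ n])
qed (auto simp: kron_def)

text \<open>Every row and column of the product is one of \<open>A\<close> padded with zeros,
  because the identity factor leaves a single admissible remainder modulo \<open>n\<close>.\<close>

lemma abs_sums_le_kron_one:
  assumes A: "A \<in> carrier_mat m m" and C: "abs_sums_le A C"
  shows "abs_sums_le (kron A (1\<^sub>m n)) C"
proof -
  have dims: "dim_row (kron A (1\<^sub>m n)) = m * n" "dim_col (kron A (1\<^sub>m n)) = m * n"
    using A by (auto simp: kron_def)
  have ind: "cmod (kron A (1\<^sub>m n) $$ (i, j))
      = cmod (A $$ (i div n, j div n)) * (if i mod n = j mod n then 1 else 0)"
    if "i < m * n" "j < m * n" for i j
    using that kron_index[OF A one_carrier_mat, of i n j] mod_less_of_less_mult[of i m n]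
      mod_less_of_less_mult[of j m n] by auto
  have "(\<Sum>j<m * n. cmod (kron A (1\<^sub>m n) $$ (i, j))) \<le> C" if i: "i < m * n" for i
  proof -
    have "(\<Sum>j<m * n. cmod (kron A (1\<^sub>m n) $$ (i, j))) = (\<Sum>u<m. cmod (A $$ (i div n, u)))"
      using i sum_div_mod[of "\<lambda>u v. cmod (A $$ (i div n, u)) * (if i mod n = v then 1 else 0)" n m]
        mod_less_of_less_mult[of i m n]
      by (simp add: ind if_distrib[of "\<lambda>x. _ * x"] cong: if_cong)
    then show ?thesis using abs_sums_le_row[OF C A, of "i div n"] i
      by (simp add: less_mult_imp_div_less)
  qed
  moreover have "(\<Sum>i<m * n. cmod (kron A (1\<^sub>m n) $$ (i, j))) \<le> C" if j: "j < m * n" for j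
  proof -
    have "(\<Sum>i<m * n. cmod (kron A (1\<^sub>m n) $$ (i, j))) = (\<Sum>u<m. cmod (A $$ (u, j div n)))"
      using j sum_div_mod[of "\<lambda>u v. cmod (A $$ (u, j div n)) * (if v = j mod n then 1 else 0)" n m]
        mod_less_of_less_mult[of j m n]
      by (simp add: ind if_distrib[of "\<lambda>x. _ * x"] cong: if_cong)
    then show ?thesis using abs_sums_le_col[OF C A, of "j div n"] j
      by (simp add: less_mult_imp_div_less)
  qed
  ultimately show ?thesis by (auto simp: abs_sums_le_def dims)
qed

section \<open>Translations and local operators\<close>

text \<open>For a bijection of the index set this is conjugation by a permutation matrix;
  multiplicativity and invariance of the trace then become reindexing of sums.\<close>

definition reindex_mat :: "(nat \<Rightarrow> nat) \<Rightarrow> complex mat \<Rightarrow> complex mat" where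
  "reindex_mat \<pi> A = mat (dim_row A) (dim_col A) (\<lambda>(i, j). A $$ (\<pi> i, \<pi> j))"

lemma reindex_mat_carrier [simp]: "reindex_mat \<pi> A \<in> carrier_mat n m \<longleftrightarrow> A \<in> carrier_mat n m"
  unfolding reindex_mat_def carrier_mat_def mem_Collect_eq dim_row_mat dim_col_mat ..

lemma reindex_mat_mult:
  assumes "bij_betw \<pi> {..<n} {..<n}" and A: "A \<in> carrier_mat n n" and B: "B \<in> carrier_mat n n"
  shows "reindex_mat \<pi> (A * B) = reindex_mat \<pi> A * reindex_mat \<pi> B"
proof (rule eq_matI)
  fix i j assume "i < dim_row (reindex_mat \<pi> A * reindex_mat \<pi> B)"
    "j < dim_col (reindex_mat \<pi> A * reindex_mat \<pi> B)"
  then have ij: "i < n" "j < n" using A B by (auto simp: reindex_mat_def)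
  then have \<pi>: "\<pi> i < n" "\<pi> j < n" using assms(1) by (auto simp: bij_betw_def)
  have "reindex_mat \<pi> (A * B) $$ (i, j) = (\<Sum>l<n. A $$ (\<pi> i, l) * B $$ (l, \<pi> j))"
    using ij \<pi> A B by (simp add: reindex_mat_def scalar_prod_def atLeast0LessThan)
  also have "\<dots> = (\<Sum>l<n. A $$ (\<pi> i, \<pi> l) * B $$ (\<pi> l, \<pi> j))"
    by (rule sum.reindex_bij_betw[OF assms(1), symmetric])
  also have "\<dots> = (reindex_mat \<pi> A * reindex_mat \<pi> B) $$ (i, j)"
    using ij A B by (simp add: reindex_mat_def scalar_prod_def atLeast0LessThan)
  finally show "reindex_mat \<pi> (A * B) $$ (i, j) = (reindex_mat \<pi> A * reindex_mat \<pi> B) $$ (i, j)" .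
qed (auto simp: reindex_mat_def)

lemma mat_trace_reindex:
  assumes "bij_betw \<pi> {..<n} {..<n}" and A: "A \<in> carrier_mat n n"
  shows "mat_trace (reindex_mat \<pi> A) = mat_trace A"
  using A sum.reindex_bij_betw[OF assms(1), of "\<lambda>i. A $$ (i, i)"]
  by (simp add: mat_trace_def reindex_mat_def)

lemma abs_sums_le_reindex:
  assumes "bij_betw \<pi> {..<n} {..<n}" and A: "A \<in> carrier_mat n n" and "abs_sums_le A C"
  shows "abs_sums_le (reindex_mat \<pi> A) C"
proof -
  have \<pi>: "\<pi> i < n" if "i < n" for i using that assms(1) by (auto simp: bij_betw_def)
  have "(\<Sum>j<n. cmod (A $$ (\<pi> i, \<pi> j))) \<le> C" if "i < n" for i
    using abs_sums_le_row[OF assms(3) A \<pi>[OF that]]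
    by (simp add: sum.reindex_bij_betw[OF assms(1), of "\<lambda>l. cmod (A $$ (\<pi> i, l))"])
  moreover have "(\<Sum>i<n. cmod (A $$ (\<pi> i, \<pi> j))) \<le> C" if "j < n" for j
    using abs_sums_le_col[OF assms(3) A \<pi>[OF that]]
    by (simp add: sum.reindex_bij_betw[OF assms(1), of "\<lambda>l. cmod (A $$ (l, \<pi> j))"])
  ultimately show ?thesis using A by (simp add: abs_sums_le_def reindex_mat_def)
qed

section \<open>The translation as a cyclic rotation of base-\<open>q\<close> digits\<close>

definition rot :: "nat \<Rightarrow> nat \<Rightarrow> nat \<Rightarrow> nat" where
  "rot q N j = (j mod q ^ (N - 1)) * q + j div q ^ (N - 1)"

lemma rot_funpow:
  assumes "m \<le> N" "j < q ^ N"
  shows "(rot q N ^^ m) j = (j mod q ^ (N - m)) * q ^ m + j div q ^ (N - m)"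
  using assms(1)
proof (induction m)
  case (Suc m)
  then obtain n where n: "N = Suc (n + m)" using nat_le_iff_add[of "Suc m" N] by auto
  \<comment> \<open>\<open>w\<close> collects the \<open>m\<close> leading digits, which have
    already moved to the end, and \<open>u\<close> the remaining ones. One more rotation moves the
    leading digit of \<open>u\<close>.\<close>
  define u w where "u = j mod q ^ Suc n" and "w = j div q ^ Suc n"
  have q: "q > 0" using assms n by (cases q) auto
  have "j < q ^ m * q ^ Suc n" using assms(2) n by (simp add: power_add mult.commute mult.left_commute)
  then have w: "w < q ^ m" unfolding w_def by (rule less_mult_imp_div_less)
  have j: "j = w * q ^ Suc n + u" by (simp only: u_def w_def div_mult_mod_eq)
  have IH: "(rot q N ^^ m) j = u * q ^ m + w" using Suc n by (simp add: u_def w_def)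
  have N1: "q ^ (N - 1) = q ^ m * q ^ n" using n by (simp add: power_add mult.commute)
  have um: "(u * q ^ m + w) div (q ^ m * q ^ n) = u div q ^ n"
    using w q by (simp add: div_mult2_eq)
  have uM: "(u * q ^ m + w) mod (q ^ m * q ^ n) = (u mod q ^ n) * q ^ m + w"
    using w q by (simp add: mod_mult2_eq)
  have 1: "u mod q ^ n = j mod q ^ n" by (simp add: u_def mod_mod_cancel)
  have "j = u + (w * q) * q ^ n" using j by (simp add: ac_simps)
  then have "j div q ^ n = (u + (w * q) * q ^ n) div q ^ n" by (rule arg_cong)
  then have 2: "j div q ^ n = w * q + u div q ^ n" using q by simp
  show ?case using n
    unfolding funpow.simps o_apply IH rot_def[of q N "u * q ^ m + w"] N1 um uM 1
    by (simp add: 2 algebra_simps)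
qed (use assms(2) in simp)

lemma translation_eq: "translation q N = mat (q ^ N) (q ^ N) (\<lambda>(i, j). if i = rot q N j then 1 else 0)"
  by (auto simp: translation_def rot_def)

lemma sum_lessThan_periodic_shift:
  fixes F :: "nat \<Rightarrow> 'a :: ab_group_add"
  assumes "F N = F 0"
  shows "(\<Sum>b<N. F (Suc b)) = (\<Sum>b<N. F b)"
  using sum.lessThan_Suc_shift[of F N] assms by simp

locale spin_chain =
  fixes q N :: nat
  assumes q_pos: "0 < q" and N_pos: "0 < N"
begin

lemma rot_bij: "bij_betw (rot q N ^^ m) {..<q ^ N} {..<q ^ N}"
proof -
  let ?r = "q ^ (N - 1)"
  have qN: "q ^ N = q * ?r" using N_pos by (cases N) auto
  have "rot q N j < q ^ N" if "j < q ^ N" for j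
  proof -
    have "j div ?r < q" using that qN by (simp add: less_mult_imp_div_less)
    then have "rot q N j < (j mod ?r + 1) * q" by (simp add: rot_def)
    also have "\<dots> \<le> ?r * q" using q_pos by (intro mult_right_mono) (auto simp: Suc_le_eq)
    finally show ?thesis using qN by (simp add: mult.commute)
  qed
  moreover have "inj_on (rot q N) {..<q ^ N}"
    using translation_index_inj[of _ q ?r] qN by (auto simp: rot_def inj_on_def)
  ultimately have "bij_betw (rot q N) {..<q ^ N} {..<q ^ N}"
    using endo_inj_surj[of "{..<q ^ N}" "rot q N"] by (auto simp: bij_betw_def)
  then show ?thesis by (rule bij_betw_funpow)
qed

lemma rot_less: "j < q ^ N \<Longrightarrow> (rot q N ^^ m) j < q ^ N"
  using rot_bij by (auto simp: bij_betw_def)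

abbreviation shift :: "nat \<Rightarrow> complex mat \<Rightarrow> complex mat" where
  "shift m \<equiv> reindex_mat (rot q N ^^ m)"

lemma translation_pow:
  "translation q N ^\<^sub>m m = mat (q ^ N) (q ^ N) (\<lambda>(i, j). if i = (rot q N ^^ m) j then 1 else 0)"
proof (induction m)
  case 0
  then show ?case by (auto simp: translation_def)
next
  case (Suc m)
  let ?M = "\<lambda>m. mat (q ^ N) (q ^ N) (\<lambda>(i, j). if i = (rot q N ^^ m) j then 1 else 0) :: complex mat"
  have "?M m * ?M 1 = ?M (Suc m)"
  proof (rule eq_matI)
    fix i j assume "i < dim_row (?M (Suc m))" "j < dim_col (?M (Suc m))"
    then have ij: "i < q ^ N" "j < q ^ N" by auto
    have "(?M m * ?M 1) $$ (i, j) = (\<Sum>l<q ^ N. ?M m $$ (i, l) * ?M 1 $$ (l, j))"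
      by (rule mat_mult_index[OF mat_carrier mat_carrier ij])
    also have "\<dots> = (\<Sum>l<q ^ N. if l = rot q N j then (if i = (rot q N ^^ m) l then 1 else 0) else 0)"
      using ij by (intro sum.cong) auto
    also have "\<dots> = ?M (Suc m) $$ (i, j)"
      using ij rot_less[OF ij(2), of 1] by (simp add: funpow_swap1)
    finally show "(?M m * ?M 1) $$ (i, j) = ?M (Suc m) $$ (i, j)" .
  qed auto
  then show ?case by (simp add: Suc translation_eq[symmetric])
qed

text \<open>Conjugation by a permutation matrix permutes both indices. From here on, translated
  operators are handled through \<open>rot\<close> instead of matrix products.\<close>

lemma on_sites_eq_shift: "on_sites q N s k a = shift s (on_first q N k a)"
proof (rule eq_matI)
  let ?T = "translation q N ^\<^sub>m s" and ?X = "on_first q N k a"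
  have X: "?X \<in> carrier_mat (q ^ N) (q ^ N)" by (simp add: on_first_def)
  have T: "?T \<in> carrier_mat (q ^ N) (q ^ N)" by (simp add: translation_pow)
  have adj: "mat_adjoint ?T = mat (q ^ N) (q ^ N) (\<lambda>(i, j). if j = (rot q N ^^ s) i then 1 else 0)"
    by (auto simp: mat_adjoint_def mat_of_rows_def translation_pow)
  fix i j assume "i < dim_row (shift s ?X)" "j < dim_col (shift s ?X)"
  then have ij: "i < q ^ N" "j < q ^ N" by (auto simp: reindex_mat_def on_first_def)
  have 1: "(mat_adjoint ?T * ?X) $$ (i, l) = ?X $$ ((rot q N ^^ s) i, l)" if "l < q ^ N" for l
    using X ij that rot_less[OF ij(1), of s]
    by (simp add: adj scalar_prod_def if_distrib[of "\<lambda>x. x * _"] cong: if_cong)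
  have AX: "mat_adjoint ?T * ?X \<in> carrier_mat (q ^ N) (q ^ N)"
    unfolding adj by (rule mult_carrier_mat[OF mat_carrier X])
  have "(mat_adjoint ?T * ?X * ?T) $$ (i, j)
      = (\<Sum>l<q ^ N. (mat_adjoint ?T * ?X) $$ (i, l) * ?T $$ (l, j))"
    by (rule mat_mult_index[OF AX T ij])
  also have "\<dots> = (\<Sum>l<q ^ N. if l = (rot q N ^^ s) j then ?X $$ ((rot q N ^^ s) i, l) else 0)"
  proof (rule sum.cong)
    fix l assume "l \<in> {..<q ^ N}"
    then have l: "l < q ^ N" by simp
    have "?T $$ (l, j) = (if l = (rot q N ^^ s) j then 1 else 0)"
      using l ij by (simp add: translation_pow)
    then show "(mat_adjoint ?T * ?X) $$ (i, l) * ?T $$ (l, j)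
        = (if l = (rot q N ^^ s) j then ?X $$ ((rot q N ^^ s) i, l) else 0)"
      unfolding 1[OF l] by simp
  qed simp
  also have "\<dots> = ?X $$ ((rot q N ^^ s) i, (rot q N ^^ s) j)"
    using rot_less[OF ij(2), of s] by simp
  finally show "on_sites q N s k a $$ (i, j) = shift s ?X $$ (i, j)"
    using ij X by (simp add: on_sites_def reindex_mat_def)
qed (auto simp: on_sites_def reindex_mat_def on_first_def mat_adjoint_def translation_pow)

lemma on_first_carrier [simp]: "on_first q N k a \<in> carrier_mat (q ^ N) (q ^ N)"
  by (simp add: on_first_def)

lemma on_sites_carrier [simp]: "on_sites q N s k a \<in> carrier_mat (q ^ N) (q ^ N)"
  by (simp add: on_sites_eq_shift)

lemma shift_mult:
  "A \<in> carrier_mat (q ^ N) (q ^ N) \<Longrightarrow> B \<in> carrier_mat (q ^ N) (q ^ N) \<Longrightarrow>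
    shift m (A * B) = shift m A * shift m B"
  by (rule reindex_mat_mult[OF rot_bij])

lemma mat_trace_shift:
  "A \<in> carrier_mat (q ^ N) (q ^ N) \<Longrightarrow> mat_trace (shift m A) = mat_trace A"
  by (rule mat_trace_reindex[OF rot_bij])

lemma shift_on_sites: "shift m (on_sites q N s k a) = on_sites q N (s + m) k a"
proof -
  have "(rot q N ^^ s) ((rot q N ^^ m) i) = (rot q N ^^ (s + m)) i" for i
    by (simp add: funpow_add)
  then show ?thesis
    using rot_less
    by (auto simp: on_sites_eq_shift reindex_mat_def on_first_def intro!: eq_matI)
qed

text \<open>A full turn of the ring is the identity, by \<open>rot_funpow\<close> with
  \<open>m = N\<close>.\<close>

lemma on_sites_add_N: "on_sites q N (s + N) k a = on_sites q N s k a"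
proof -
  have "(rot q N ^^ (s + N)) i = (rot q N ^^ s) i" if "i < q ^ N" for i
    using that rot_funpow[of N N i q] by (simp add: funpow_add)
  then show ?thesis
    by (auto simp: on_sites_eq_shift reindex_mat_def on_first_def intro!: eq_matI)
qed

lemma on_sites_mod_N: "on_sites q N (s mod N) k a = on_sites q N s k a"
proof -
  have "on_sites q N (r + m * N) k a = on_sites q N r k a" for r m
  proof (induction m)
    case (Suc m)
    then show ?case using on_sites_add_N[of "r + m * N" k a] by (simp add: ac_simps)
  qed simp
  from this[of "s mod N" "s div N"] show ?thesis by simp
qed

lemma on_sites_0: "on_sites q N 0 k a = on_first q N k a"
  by (auto simp: on_sites_eq_shift reindex_mat_def on_first_def intro!: eq_matI)

section \<open>Local operators as tensor products\<close>

lemma on_first_kron: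
  assumes "a \<in> carrier_mat (q ^ k) (q ^ k)" "k \<le> N"
  shows "on_first q N k a = kron a (1\<^sub>m (q ^ (N - k)))"
proof (rule eq_matI)
  have qN: "q ^ N = q ^ k * q ^ (N - k)" using assms(2) by (simp add: power_add[symmetric])
  fix i j assume "i < dim_row (kron a (1\<^sub>m (q ^ (N - k))))" "j < dim_col (kron a (1\<^sub>m (q ^ (N - k))))"
  then have ij: "i < q ^ k * q ^ (N - k)" "j < q ^ k * q ^ (N - k)"
    using assms(1) by (auto simp: kron_def)
  then show "on_first q N k a $$ (i, j) = kron a (1\<^sub>m (q ^ (N - k))) $$ (i, j)"
    using qN mod_less_of_less_mult[OF ij(1)] mod_less_of_less_mult[OF ij(2)]
    by (simp add: kron_index[OF assms(1) one_carrier_mat ij] on_first_def)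
qed (use assms in \<open>auto simp: on_first_def kron_def power_add[symmetric]\<close>)

text \<open>The \<open>b\<close>-fold rotation exchanges the \<open>b\<close> leading digits of an
  index with the \<open>N - b\<close> trailing ones, hence the two tensor factors.\<close>

lemma shift_kron:
  assumes "b \<le> N" and A: "A \<in> carrier_mat (q ^ (N - b)) (q ^ (N - b))"
    and B: "B \<in> carrier_mat (q ^ b) (q ^ b)"
  shows "shift b (kron A B) = kron B A"
proof (rule eq_matI)
  let ?n = "q ^ (N - b)" and ?m = "q ^ b" and ?r = "rot q N ^^ b"
  have qN: "q ^ N = ?m * ?n" using assms(1) by (simp add: power_add[symmetric])
  fix i j assume "i < dim_row (kron B A)" "j < dim_col (kron B A)"
  then have ij: "i < q ^ N" "j < q ^ N" using A B qN by (auto simp: kron_def)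
  have r: "?r x div ?m = x mod ?n" "?r x mod ?m = x div ?n" if "x < q ^ N" for x
  proof -
    have "x div ?n < ?m" using that qN by (simp add: less_mult_imp_div_less)
    then show "?r x div ?m = x mod ?n" "?r x mod ?m = x div ?n"
      using rot_funpow[OF assms(1) that] q_pos by simp_all
  qed
  have lt: "?r i < ?n * ?m" "?r j < ?n * ?m"
    using rot_less[OF ij(1)] rot_less[OF ij(2)] qN by (simp_all add: mult.commute)
  have dims: "dim_row (kron A B) = q ^ N" "dim_col (kron A B) = q ^ N"
    using A B qN by (auto simp: kron_def mult.commute)
  have "shift b (kron A B) $$ (i, j) = kron A B $$ (?r i, ?r j)"
    using ij by (simp add: reindex_mat_def dims)
  also have "\<dots> = kron B A $$ (i, j)"
    using ij r by (simp add: kron_index[OF A B lt] kron_index[OF B A ij[unfolded qN]] mult.commute)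
  finally show "shift b (kron A B) $$ (i, j) = kron B A $$ (i, j)" .
qed (use A B in \<open>auto simp: kron_def reindex_mat_def mult.commute\<close>)

text \<open>The condition \<open>b + k \<le> N\<close> says that the block does not wrap around the
  end of the chain. The identity to the right of \<open>a\<close> is split, and its last
  \<open>b\<close> spins are rotated to the front by \<open>shift_kron\<close>.\<close>

lemma on_sites_kron:
  assumes a: "a \<in> carrier_mat (q ^ k) (q ^ k)" and "b + k \<le> N"
  shows "on_sites q N b k a = kron (1\<^sub>m (q ^ b)) (kron a (1\<^sub>m (q ^ (N - k - b))))"
proof -
  have 1: "(1\<^sub>m (q ^ (N - k)) :: complex mat) = kron (1\<^sub>m (q ^ (N - k - b))) (1\<^sub>m (q ^ b))"
    using assms(2) by (simp add: kron_one power_add[symmetric])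
  have "q ^ k * q ^ (N - k - b) = q ^ (N - b)" using assms(2) by (simp add: power_add[symmetric])
  then have c: "kron a (1\<^sub>m (q ^ (N - k - b))) \<in> carrier_mat (q ^ (N - b)) (q ^ (N - b))"
    using kron_carrier[OF a one_carrier_mat[of "q ^ (N - k - b)"]] by simp
  have "on_first q N k a = kron (kron a (1\<^sub>m (q ^ (N - k - b)))) (1\<^sub>m (q ^ b))"
    using assms(2) by (simp add: on_first_kron[OF a] 1 kron_assoc[OF a one_carrier_mat one_carrier_mat])
  then show ?thesis
    using assms(2) shift_kron[OF _ c one_carrier_mat] by (simp add: on_sites_eq_shift)
qed

lemma abs_sums_le_on_sites:
  assumes "a \<in> carrier_mat (q ^ k) (q ^ k)" "k \<le> N" "abs_sums_le a C"
  shows "abs_sums_le (on_sites q N s k a) C"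
  unfolding on_sites_eq_shift
  by (rule abs_sums_le_reindex[OF rot_bij on_first_carrier])
    (simp add: on_first_kron[OF assms(1,2)] abs_sums_le_kron_one[OF assms(1,3)])

lemma mat_trace_on_sites:
  assumes "a \<in> carrier_mat (q ^ k) (q ^ k)" "k \<le> N"
  shows "mat_trace (on_sites q N s k a) = mat_trace a * of_nat (q ^ (N - k))"
  unfolding on_sites_eq_shift mat_trace_shift[OF on_first_carrier]
  by (simp add: on_first_kron[OF assms] mat_trace_kron[OF assms(1) one_carrier_mat])

text \<open>Only disjointness from the first block is recorded, not the support itself. Products of
  local terms thus stay in the class however their supports overlap each other.\<close>

definition trivial_on_first :: "nat \<Rightarrow> complex mat \<Rightarrow> bool" where
  "trivial_on_first k X \<longleftrightarrow>
     (\<exists>Y \<in> carrier_mat (q ^ (N - k)) (q ^ (N - k)). X = kron (1\<^sub>m (q ^ k)) Y)"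

lemma trivial_on_first_on_sites:
  assumes a: "a \<in> carrier_mat (q ^ l) (q ^ l)" and "k \<le> b" "b + l \<le> N"
  shows "trivial_on_first k (on_sites q N b l a)"
proof -
  let ?Z = "kron a (1\<^sub>m (q ^ (N - l - b)))"
  have b: "(1\<^sub>m (q ^ b) :: complex mat) = kron (1\<^sub>m (q ^ k)) (1\<^sub>m (q ^ (b - k)))"
    using assms(2) by (simp add: kron_one power_add[symmetric])
  have Z: "?Z \<in> carrier_mat (q ^ (l + (N - l - b))) (q ^ (l + (N - l - b)))"
    using kron_carrier[OF a one_carrier_mat] by (simp add: power_add)
  have "b - k + (l + (N - l - b)) = N - k" using assms by simp
  then have "kron (1\<^sub>m (q ^ (b - k))) ?Z \<in> carrier_mat (q ^ (N - k)) (q ^ (N - k))"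
    using kron_carrier[OF one_carrier_mat[of "q ^ (b - k)"] Z] by (simp add: power_add[symmetric])
  moreover have "on_sites q N b l a = kron (1\<^sub>m (q ^ k)) (kron (1\<^sub>m (q ^ (b - k))) ?Z)"
    unfolding on_sites_kron[OF a assms(3)] b by (rule kron_assoc[OF one_carrier_mat one_carrier_mat Z])
  ultimately show ?thesis by (auto simp: trivial_on_first_def)
qed

lemma trivial_on_first_mult:
  assumes "trivial_on_first k X" "trivial_on_first k Y"
  shows "trivial_on_first k (X * Y)"
proof -
  obtain A B where "A \<in> carrier_mat (q ^ (N - k)) (q ^ (N - k))" "X = kron (1\<^sub>m (q ^ k)) A"
    and "B \<in> carrier_mat (q ^ (N - k)) (q ^ (N - k))" "Y = kron (1\<^sub>m (q ^ k)) B"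
    using assms by (auto simp: trivial_on_first_def)
  moreover from this have "X * Y = kron (1\<^sub>m (q ^ k)) (A * B)"
    by (simp add: kron_mult[of _ "q ^ k" _ "q ^ (N - k)"])
  ultimately show ?thesis unfolding trivial_on_first_def by (intro bexI[of _ "A * B"]) auto
qed

text \<open>The product is \<open>kron a Y\<close>, so its trace contains the factor
  \<open>mat_trace a\<close>.\<close>

lemma mat_trace_on_first_mult_trivial:
  assumes a: "a \<in> carrier_mat (q ^ k) (q ^ k)" "mat_trace a = 0" and "k \<le> N"
    and "trivial_on_first k X"
  shows "mat_trace (on_sites q N 0 k a * X) = 0"
proof -
  obtain Y where Y: "Y \<in> carrier_mat (q ^ (N - k)) (q ^ (N - k))" "X = kron (1\<^sub>m (q ^ k)) Y"
    using assms(4) by (auto simp: trivial_on_first_def)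
  have "on_sites q N 0 k a * X = kron a Y"
    using a Y by (simp add: on_sites_0 on_first_kron[OF a(1) assms(3)] kron_mult[of _ "q ^ k" _ "q ^ (N - k)"])
  then show ?thesis using mat_trace_kron[OF a(1) Y(1)] a(2) by simp
qed

section \<open>Traces involving the Hamiltonian\<close>

lemma hamiltonian_carrier [simp]: "hamiltonian q N k h \<in> carrier_mat (q ^ N) (q ^ N)"
  by (simp add: hamiltonian_def)

lemma mat_trace_hamiltonian_mult:
  assumes X: "X \<in> carrier_mat (q ^ N) (q ^ N)"
  shows "mat_trace (hamiltonian q N k h * X) = (\<Sum>l<N. mat_trace (on_sites q N l k h * X))"
proof -
  have "mat_trace (hamiltonian q N k h * X)
      = (\<Sum>i<q ^ N. \<Sum>j<q ^ N. \<Sum>l<N. on_sites q N l k h $$ (i, j) * X $$ (j, i))"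
    unfolding mat_trace_mult[OF hamiltonian_carrier X]
    by (simp add: hamiltonian_def sum_distrib_right)
  also have "\<dots> = (\<Sum>i<q ^ N. \<Sum>l<N. \<Sum>j<q ^ N. on_sites q N l k h $$ (i, j) * X $$ (j, i))"
    by (intro sum.cong refl sum.swap)
  also have "\<dots> = (\<Sum>l<N. \<Sum>i<q ^ N. \<Sum>j<q ^ N. on_sites q N l k h $$ (i, j) * X $$ (j, i))"
    by (rule sum.swap)
  finally show ?thesis by (simp add: mat_trace_mult[OF on_sites_carrier X])
qed

lemma mat_trace_hamiltonian:
  assumes "h \<in> carrier_mat (q ^ k) (q ^ k)" "k \<le> N" "mat_trace h = 0"
  shows "mat_trace (hamiltonian q N k h) = 0"
proof -
  have "mat_trace (hamiltonian q N k h) = (\<Sum>l<N. mat_trace (on_sites q N l k h * 1\<^sub>m (q ^ N)))"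
    using mat_trace_hamiltonian_mult[OF one_carrier_mat, of k h]
    by (simp only: right_mult_one_mat[OF hamiltonian_carrier])
  then show ?thesis
    by (simp only: right_mult_one_mat[OF on_sites_carrier] mat_trace_on_sites[OF assms(1,2)] assms(3)
        mult_zero_left sum.neutral_const)
qed

lemma mat_trace_on_sites_shift:
  "mat_trace (on_sites q N (b + m) k h * on_sites q N (s + m) l a)
    = mat_trace (on_sites q N b k h * on_sites q N s l a)"
  unfolding shift_on_sites[symmetric] shift_mult[OF on_sites_carrier on_sites_carrier, symmetric]
  by (rule mat_trace_shift[OF mult_carrier_mat[OF on_sites_carrier on_sites_carrier]])

text \<open>By translation invariance of the Hamiltonian the position \<open>s\<close> does not
  matter. Each induction step moves both operators back by one site; the summand is periodic in
  \<open>b\<close>, so the sum over the ring absorbs the shift.\<close>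

lemma mat_trace_hamiltonian_on_sites:
  "mat_trace (hamiltonian q N k h * on_sites q N s l a)
    = (\<Sum>b<N. mat_trace (on_sites q N b k h * on_sites q N 0 l a))"
proof -
  have "(\<Sum>b<N. mat_trace (on_sites q N b k h * on_sites q N s l a))
      = (\<Sum>b<N. mat_trace (on_sites q N b k h * on_sites q N 0 l a))"
  proof (induction s)
    case (Suc s)
    let ?F = "\<lambda>b. mat_trace (on_sites q N b k h * on_sites q N (Suc s) l a)"
    have "on_sites q N N k h = on_sites q N 0 k h"
      using on_sites_add_N[of 0 k h] by (simp only: add_0)
    then have "(\<Sum>b<N. ?F b) = (\<Sum>b<N. ?F (Suc b))"
      by (intro sum_lessThan_periodic_shift[symmetric]) (simp only:)
    also have "\<dots> = (\<Sum>b<N. mat_trace (on_sites q N b k h * on_sites q N s l a))"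
      using mat_trace_on_sites_shift[of _ 1 k h s l a] by (simp only: Suc_eq_plus1)
    finally show ?case using Suc by (rule trans)
  qed (rule refl)
  then show ?thesis unfolding mat_trace_hamiltonian_mult[OF on_sites_carrier] .
qed

lemma mat_trace_hamiltonian_square:
  "mat_trace (hamiltonian q N k h * hamiltonian q N k h)
    = of_nat N * mat_trace (hamiltonian q N k h * on_first q N k h)"
proof -
  have "mat_trace (on_sites q N l k h * hamiltonian q N k h)
      = mat_trace (hamiltonian q N k h * on_first q N k h)" for l
  proof -
    have "mat_trace (on_sites q N l k h * hamiltonian q N k h)
        = mat_trace (hamiltonian q N k h * on_sites q N l k h)"
      by (rule mat_trace_cyclic[OF on_sites_carrier hamiltonian_carrier])
    also have "\<dots> = mat_trace (hamiltonian q N k h * on_sites q N 0 k h)"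
      by (simp only: mat_trace_hamiltonian_on_sites)
    finally show ?thesis by (simp only: on_sites_0)
  qed
  then show ?thesis by (simp add: mat_trace_hamiltonian_mult[OF hamiltonian_carrier])
qed

end

section \<open>Dependence on the length of the chain\<close>

context spin_chain
begin

text \<open>A block that does not wrap in the shorter chain has the same tensor form in the longer
  one; only the trailing identity grows, and it splits at site \<open>M\<close>.\<close>

lemma on_sites_enlarge:
  assumes a: "a \<in> carrier_mat (q ^ k) (q ^ k)" and "0 < M" "b + k \<le> M" "M \<le> N"
  shows "on_sites q N b k a = kron (on_sites q M b k a) (1\<^sub>m (q ^ (N - M)))"
proof -
  interpret M: spin_chain q M using assms(2) q_pos by unfold_locales
  let ?B = "1\<^sub>m (q ^ b)" and ?R = "1\<^sub>m (q ^ (M - k - b))" and ?Z = "1\<^sub>m (q ^ (N - M))"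
  have 1: "1\<^sub>m (q ^ (N - k - b)) = kron ?R ?Z"
    using assms(3,4) by (simp add: kron_one power_add[symmetric])
  have aR: "kron a ?R \<in> carrier_mat (q ^ k * q ^ (M - k - b)) (q ^ k * q ^ (M - k - b))"
    by (rule kron_carrier[OF a one_carrier_mat])
  have "on_sites q N b k a = kron ?B (kron a (kron ?R ?Z))"
    using assms on_sites_kron[OF a, of b] 1 by simp
  also have "\<dots> = kron (kron ?B (kron a ?R)) ?Z"
    unfolding kron_assoc[OF a one_carrier_mat one_carrier_mat, symmetric]
      kron_assoc[OF one_carrier_mat aR one_carrier_mat] ..
  also have "kron ?B (kron a ?R) = on_sites q M b k a"
    using M.on_sites_kron[OF a assms(3)] by simp
  finally show ?thesis .
qed

lemma mat_trace_on_sites_enlarge: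
  assumes h: "h \<in> carrier_mat (q ^ k) (q ^ k)" and a: "a \<in> carrier_mat (q ^ l) (q ^ l)"
    and "0 < M" "b + k \<le> M" "c + l \<le> M" "M \<le> N"
  shows "mat_trace (on_sites q N b k h * on_sites q N c l a)
    = mat_trace (on_sites q M b k h * on_sites q M c l a) * of_nat (q ^ (N - M))"
proof -
  interpret M: spin_chain q M using assms(3) q_pos by unfold_locales
  show ?thesis
    unfolding on_sites_enlarge[OF h assms(3,4,6)] on_sites_enlarge[OF a assms(3,5,6)]
      kron_mult[OF M.on_sites_carrier one_carrier_mat M.on_sites_carrier one_carrier_mat]
      left_mult_one_mat[OF one_carrier_mat]
      mat_trace_kron[OF mult_carrier_mat[OF M.on_sites_carrier M.on_sites_carrier] one_carrier_mat]
      mat_trace_one ..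
qed

end

text \<open>This is the reason why the slope is independent of \<open>N\<close>. Only the fewer than
  \<open>k + l\<close> terms overlapping \<open>a\<close> contribute, and each fits, after a
  rotation if necessary, into a chain of \<open>k + l\<close> sites. The constant is the sum of
  their traces there, divided by the dimension of that chain.\<close>

lemma mat_trace_hamiltonian_on_sites_extensive:
  assumes h: "h \<in> carrier_mat (q ^ k) (q ^ k)" and a: "a \<in> carrier_mat (q ^ l) (q ^ l)"
    and tr: "mat_trace a = 0" and "0 < q" "0 < k"
  obtains c where "\<And>N s. k + l \<le> N \<Longrightarrow>
    mat_trace (hamiltonian q N k h * on_sites q N s l a) = c * of_nat (q ^ N)"
proof
  let ?G = "\<lambda>N b c. mat_trace (on_sites q N b k h * on_sites q N c l a)"
  let ?M = "k + l"
  let ?c = "((\<Sum>b<l. ?G ?M b 0) + (\<Sum>c\<in>{1..<k}. ?G ?M 0 c)) / of_nat (q ^ ?M)"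
  fix N s assume N: "?M \<le> N"
  interpret spin_chain q N using assms N by unfold_locales auto
  have M: "0 < ?M" using assms by simp
  \<comment> \<open>The ranges of \<open>b\<close> are: blocks starting inside the support of
    \<open>a\<close>, blocks disjoint from it, and blocks wrapping around the end of the
    chain.\<close>
  have "{..<N} = {..<l} \<union> {l..<N + 1 - k} \<union> {N + 1 - k..<N}" using N assms(5) by auto
  then have "(\<Sum>b<N. ?G N b 0) = (\<Sum>b\<in>{..<l} \<union> {l..<N + 1 - k} \<union> {N + 1 - k..<N}. ?G N b 0)"
    by (rule sum.cong) simp
  also have "\<dots> = (\<Sum>b<l. ?G N b 0) + (\<Sum>b\<in>{l..<N + 1 - k}. ?G N b 0) + (\<Sum>b\<in>{N + 1 - k..<N}. ?G N b 0)"
    using N by (subst sum.union_disjoint; (subst sum.union_disjoint)?) auto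
  also have "(\<Sum>b\<in>{l..<N + 1 - k}. ?G N b 0) = 0"
  proof (rule sum.neutral, rule ballI)
    fix b assume "b \<in> {l..<N + 1 - k}"
    then have "trivial_on_first l (on_sites q N b k h)"
      by (intro trivial_on_first_on_sites[OF h]) auto
    then have "mat_trace (on_sites q N 0 l a * on_sites q N b k h) = 0"
      using N by (intro mat_trace_on_first_mult_trivial[OF a tr]) auto
    then show "?G N b 0 = 0"
      using mat_trace_cyclic[OF on_sites_carrier[of b k h] on_sites_carrier[of 0 l a]] by simp
  qed
  \<comment> \<open>Rotating by \<open>N - b\<close> unwraps the pair: \<open>h\<close> moves to
    site 0 and \<open>a\<close> to site \<open>N - b\<close>, which is less than
    \<open>k\<close>.\<close>
  also have "(\<Sum>b\<in>{N + 1 - k..<N}. ?G N b 0) = (\<Sum>c\<in>{1..<k}. ?G N 0 c)"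
  proof (rule sum.reindex_bij_witness[where i = "\<lambda>c. N - c" and j = "\<lambda>b. N - b"])
    fix b assume b: "b \<in> {N + 1 - k..<N}"
    have "?G N b 0 = ?G N (b + (N - b)) (0 + (N - b))"
      by (rule mat_trace_on_sites_shift[symmetric])
    also have "b + (N - b) = 0 + N" using b by simp
    finally show "?G N 0 (N - b) = ?G N b 0" unfolding on_sites_add_N by simp
  qed (use N in auto)
  also have "(\<Sum>b<l. ?G N b 0) = (\<Sum>b<l. ?G ?M b 0) * of_nat (q ^ (N - ?M))"
    unfolding sum_distrib_right
    by (intro sum.cong refl mat_trace_on_sites_enlarge[OF h a M _ _ N]) auto
  also have "(\<Sum>c\<in>{1..<k}. ?G N 0 c) = (\<Sum>c\<in>{1..<k}. ?G ?M 0 c) * of_nat (q ^ (N - ?M))"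
    unfolding sum_distrib_right
    by (intro sum.cong refl mat_trace_on_sites_enlarge[OF h a M _ _ N]) auto
  also have "of_nat (q ^ (N - ?M)) = (of_nat (q ^ N) / of_nat (q ^ ?M) :: complex)"
  proof -
    have "q ^ N = q ^ (N - ?M) * q ^ ?M" using N by (simp add: power_add[symmetric])
    then have "of_nat (q ^ N) = (of_nat (q ^ (N - ?M)) * of_nat (q ^ ?M) :: complex)"
      by (simp only: of_nat_mult)
    moreover have "(of_nat (q ^ ?M) :: complex) \<noteq> 0" using assms(4) by simp
    ultimately show ?thesis by (simp only: nonzero_mult_div_cancel_right not_False_eq_True)
  qed
  finally show "mat_trace (hamiltonian q N k h * on_sites q N s l a) = ?c * of_nat (q ^ N)"
    unfolding mat_trace_hamiltonian_on_sites[of k h s l a]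
    by (simp only: times_divide_eq_right times_divide_eq_left distrib_right add_divide_distrib add_0_right)
qed

section \<open>The fourth moment of the energy\<close>

text \<open>If neither of the first three entries of a quadruple is isolated, the quadruple contains
  two edges of the proximity graph that do not form a cycle, so only two entries are free.\<close>

lemma card_quadruples_not_isolated:
  fixes nb :: "nat \<Rightarrow> nat \<Rightarrow> nat" and D N :: nat
  defines "near \<equiv> \<lambda>x y. \<exists>i<D. y = nb x i"
  assumes sym: "\<And>x y. x < N \<Longrightarrow> y < N \<Longrightarrow> near x y \<Longrightarrow> near y x"
  shows "card {(a, b, c, d). a < N \<and> b < N \<and> c < N \<and> d < N
      \<and> (near a b \<or> near a c \<or> near a d) \<and> (near b c \<or> near b d \<or> near b a)
      \<and> (near c d \<or> near c a \<or> near c b)} \<le> 8 * (N * D)\<^sup>2" (is "card ?S \<le> _")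
proof -
  \<comment> \<open>One map for each pair of edges: \<open>x\<close> and \<open>y\<close> are the
    free entries, \<open>i\<close> and \<open>j\<close> select neighbours. In order, the pairs are
    ab,ac; ab,bc; ab,cd; ac,bc; ac,bd; ab,ad; ad,bc; ad,bd. Their number is the factor 8.\<close>
  define fs where "fs =
    [\<lambda>(x, y, i, j). (x, nb x i, nb x j, y), \<lambda>(x, y, i, j). (nb x i, x, nb x j, y),
     \<lambda>(x, y, i, j). (x, nb x i, y, nb y j), \<lambda>(x, y, i, j). (nb x i, nb x j, x, y),
     \<lambda>(x, y, i, j). (x, y, nb x i, nb y j), \<lambda>(x, y, i, j). (x, nb x i, y, nb x j),
     \<lambda>(x, y, i, j). (x, y, nb y j, nb x i), \<lambda>(x, y, i, j). (nb x i, nb x j, y, x)]"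
  define P where "P = {..<N} \<times> {..<N} \<times> {..<D} \<times> {..<D}"
  define U where "U = (\<Union>f\<in>set fs. f ` P)"
  have mem: "f (x, y, i, j) \<in> U" if "f \<in> set fs" "x < N" "y < N" "i < D" "j < D" for f x y i j
    using that by (auto simp: U_def P_def)
  have "?S \<subseteq> U"
  proof clarify
    fix a b c d assume lt: "a < N" "b < N" "c < N" "d < N"
      and A: "near a b \<or> near a c \<or> near a d" and B: "near b c \<or> near b d \<or> near b a"
      and C: "near c d \<or> near c a \<or> near c b"
    have abac: "(a, b, c, d) \<in> U" if ab: "near a b" and ac: "near a c"
    proof -
      obtain i j where "i < D" "b = nb a i" "j < D" "c = nb a j"
        using ab ac unfolding near_def by blast
      then show ?thesis using mem[of "fs ! 0" a d i j] lt by (simp add: fs_def)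
    qed
    have "(a, b, c, d) \<in> U" if ab: "near a b"
    proof -
      consider "near a c" | "near b c" | "near c d" using C sym lt by blast
      then show ?thesis
      proof cases
        case 1 then show ?thesis using ab abac by simp
      next
        case 2
        then obtain i j where "i < D" "a = nb b i" "j < D" "c = nb b j"
          using sym[OF lt(1,2) ab] unfolding near_def by blast
        then show ?thesis using mem[of "fs ! 1" b d i j] lt by (simp add: fs_def)
      next
        case 3
        then obtain i j where "i < D" "b = nb a i" "j < D" "d = nb c j"
          using ab unfolding near_def by blast
        then show ?thesis using mem[of "fs ! 2" a c i j] lt by (simp add: fs_def)
      qed
    qed
    moreover have "(a, b, c, d) \<in> U" if ac: "near a c"
    proof -
      consider "near a b" | "near b c" | "near b d" using B sym lt by blast
      then show ?thesis
      proof cases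
        case 1 then show ?thesis using ac abac by simp
      next
        case 2
        then obtain i j where "i < D" "a = nb c i" "j < D" "b = nb c j"
          using sym[OF lt(1,3) ac] sym[OF lt(2,3)] unfolding near_def by blast
        then show ?thesis using mem[of "fs ! 3" c d i j] lt by (simp add: fs_def)
      next
        case 3
        then obtain i j where "i < D" "c = nb a i" "j < D" "d = nb b j"
          using ac unfolding near_def by blast
        then show ?thesis using mem[of "fs ! 4" a b i j] lt by (simp add: fs_def)
      qed
    qed
    moreover have "(a, b, c, d) \<in> U" if ad: "near a d"
    proof -
      consider "near a b" | "near b c" | "near b d" using B sym lt by blast
      then show ?thesis
      proof cases
        case 1
        then obtain i j where "i < D" "b = nb a i" "j < D" "d = nb a j"
          using ad unfolding near_def by blast
        then show ?thesis using mem[of "fs ! 5" a c i j] lt by (simp add: fs_def)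
      next
        case 2
        then obtain i j where "i < D" "d = nb a i" "j < D" "c = nb b j"
          using ad unfolding near_def by blast
        then show ?thesis using mem[of "fs ! 6" a b i j] lt by (simp add: fs_def)
      next
        case 3
        then obtain i j where "i < D" "a = nb d i" "j < D" "b = nb d j"
          using sym[OF lt(1,4) ad] sym[OF lt(2,4)] unfolding near_def by blast
        then show ?thesis using mem[of "fs ! 7" d c i j] lt by (simp add: fs_def)
      qed
    qed
    ultimately show "(a, b, c, d) \<in> U" using A by blast
  qed
  moreover have finP: "finite P" by (simp add: P_def)
  then have "finite U" by (simp add: U_def)
  ultimately have "card ?S \<le> card U" by (intro card_mono)
  also have "\<dots> \<le> (\<Sum>f\<in>set fs. card (f ` P))" unfolding U_def by (rule card_UN_le) simp
  also have "\<dots> \<le> (\<Sum>f\<in>set fs. card P)" by (intro sum_mono card_image_le finP)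
  also have "\<dots> = card (set fs) * card P" by simp
  also have "\<dots> \<le> 8 * card P" using card_length[of fs] by (intro mult_right_mono) (auto simp: fs_def)
  also have "card P = (N * D)\<^sup>2" by (simp add: P_def power2_eq_square card_cartesian_product)
  finally show ?thesis .
qed

section \<open>The trace of the fourth power of the Hamiltonian\<close>

context spin_chain
begin

lemma mat_trace_four_rotate:
  assumes "A \<in> carrier_mat (q ^ N) (q ^ N)" "B \<in> carrier_mat (q ^ N) (q ^ N)"
    "C \<in> carrier_mat (q ^ N) (q ^ N)" "D \<in> carrier_mat (q ^ N) (q ^ N)"
  shows "mat_trace (A * (B * (C * D))) = mat_trace (B * (C * (D * A)))"
proof -
  let ?n = "q ^ N"
  have "mat_trace (A * (B * (C * D))) = mat_trace ((B * (C * D)) * A)"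
    by (intro mat_trace_cyclic[of _ ?n ?n] mult_carrier_mat[of _ ?n ?n] assms)
  also have "(B * (C * D)) * A = B * ((C * D) * A)"
    by (intro assoc_mult_mat[of _ ?n ?n _ ?n _ ?n] mult_carrier_mat[of _ ?n ?n] assms)
  also have "(C * D) * A = C * (D * A)"
    by (intro assoc_mult_mat[of _ ?n ?n _ ?n _ ?n] assms)
  finally show ?thesis .
qed

text \<open>Linearity is available in the leading factor, so each expansion is followed by a cyclic
  rotation that brings the next factor to the front. Four rounds restore the original order.\<close>

lemma mat_trace_hamiltonian_pow4:
  "mat_trace (hamiltonian q N k h * (hamiltonian q N k h * (hamiltonian q N k h * hamiltonian q N k h)))
    = (\<Sum>a<N. \<Sum>b<N. \<Sum>c<N. \<Sum>d<N. mat_trace (on_sites q N a k h *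
        (on_sites q N b k h * (on_sites q N c k h * on_sites q N d k h))))"
proof -
  define H where "H = hamiltonian q N k h"
  have H: "H \<in> carrier_mat (q ^ N) (q ^ N)" by (simp add: H_def)
  let ?h = "\<lambda>a. on_sites q N a k h"
  have m: "X * Y \<in> carrier_mat (q ^ N) (q ^ N)"
    if "X \<in> carrier_mat (q ^ N) (q ^ N)" "Y \<in> carrier_mat (q ^ N) (q ^ N)" for X Y :: "complex mat"
    using that by (rule mult_carrier_mat)
  note ex = mat_trace_hamiltonian_mult[of _ k h, folded H_def]
  note rot = mat_trace_four_rotate
  note hc = on_sites_carrier[of _ k h]
  have "mat_trace (H * (H * (H * H))) = (\<Sum>a<N. mat_trace (?h a * (H * (H * H))))"
    by (intro ex m H)
  also have "\<dots> = (\<Sum>a<N. mat_trace (H * (H * (H * ?h a))))"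
    by (intro sum.cong refl rot H hc)
  also have "\<dots> = (\<Sum>a<N. \<Sum>b<N. mat_trace (?h b * (H * (H * ?h a))))"
    by (intro sum.cong refl ex m H hc)
  also have "\<dots> = (\<Sum>a<N. \<Sum>b<N. mat_trace (H * (H * (?h a * ?h b))))"
    by (intro sum.cong refl rot H hc)
  also have "\<dots> = (\<Sum>a<N. \<Sum>b<N. \<Sum>c<N. mat_trace (?h c * (H * (?h a * ?h b))))"
    by (intro sum.cong refl ex m H hc)
  also have "\<dots> = (\<Sum>a<N. \<Sum>b<N. \<Sum>c<N. mat_trace (H * (?h a * (?h b * ?h c))))"
    by (intro sum.cong refl rot H hc)
  also have "\<dots> = (\<Sum>a<N. \<Sum>b<N. \<Sum>c<N. \<Sum>d<N. mat_trace (?h d * (?h a * (?h b * ?h c))))"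
    by (intro sum.cong refl ex m H hc)
  also have "\<dots> = (\<Sum>a<N. \<Sum>b<N. \<Sum>c<N. \<Sum>d<N. mat_trace (?h a * (?h b * (?h c * ?h d))))"
    by (intro sum.cong refl rot H hc)
  finally show ?thesis by (simp only: H_def)
qed

text \<open>Rotating the ring by \<open>N - a\<close> puts the isolated term on the first
  \<open>k\<close> spins. The hypothesis \<open>far\<close> says that the other blocks then neither
  start inside these spins nor wrap back into them, so their product acts trivially there.\<close>

lemma mat_trace_four_on_sites_eq_0:
  assumes h: "h \<in> carrier_mat (q ^ k) (q ^ k)" "mat_trace h = 0" and "k \<le> N" and "a < N"
    and far: "\<And>x. x \<in> {b, c, d} \<Longrightarrow> k \<le> (x + (N - a)) mod N \<and> (x + (N - a)) mod N + k \<le> N"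
  shows "mat_trace (on_sites q N a k h *
    (on_sites q N b k h * (on_sites q N c k h * on_sites q N d k h))) = 0"
proof -
  let ?h = "\<lambda>a. on_sites q N a k h"
  have m: "X * Y \<in> carrier_mat (q ^ N) (q ^ N)"
    if "X \<in> carrier_mat (q ^ N) (q ^ N)" "Y \<in> carrier_mat (q ^ N) (q ^ N)" for X Y :: "complex mat"
    using that by (rule mult_carrier_mat)
  have sm: "shift (N - a) (X * Y) = shift (N - a) X * shift (N - a) Y"
    if "X \<in> carrier_mat (q ^ N) (q ^ N)" "Y \<in> carrier_mat (q ^ N) (q ^ N)" for X Y :: "complex mat"
    using that by (rule shift_mult)
  note hc = on_sites_carrier[of _ k h]
  have tr: "trivial_on_first k (?h (x + (N - a)))" if "x \<in> {b, c, d}" for x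
    using trivial_on_first_on_sites[OF h(1), of k "(x + (N - a)) mod N"] far[OF that]
    by (simp only: on_sites_mod_N)
  have "mat_trace (?h a * (?h b * (?h c * ?h d)))
      = mat_trace (shift (N - a) (?h a * (?h b * (?h c * ?h d))))"
    by (intro mat_trace_shift[symmetric] m hc)
  also have "shift (N - a) (?h a * (?h b * (?h c * ?h d)))
      = shift (N - a) (?h a) * (shift (N - a) (?h b) * (shift (N - a) (?h c) * shift (N - a) (?h d)))"
    by (simp only: sm m hc)
  also have "\<dots> = ?h (0 + N) * (?h (b + (N - a)) * (?h (c + (N - a)) * ?h (d + (N - a))))"
    unfolding shift_on_sites using assms(4) by simp
  also have "mat_trace \<dots> = 0"
    unfolding on_sites_add_N
    by (intro mat_trace_on_first_mult_trivial[OF h assms(3)] trivial_on_first_mult tr) auto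
  finally show ?thesis .
qed

text \<open>At most \<open>8 * (N * (2 * k))\<^sup>2\<close> quadruples survive, each contributing
  at most \<open>C ^ 4 * real (q ^ N)\<close>; this gives the constant 32.\<close>

lemma norm_mat_trace_hamiltonian_pow4_le:
  assumes h: "h \<in> carrier_mat (q ^ k) (q ^ k)" "mat_trace h = 0" and "0 < k" "k \<le> N"
    and C: "abs_sums_le h C" "0 \<le> C"
  shows "cmod (mat_trace (hamiltonian q N k h *
      (hamiltonian q N k h * (hamiltonian q N k h * hamiltonian q N k h))))
    \<le> 32 * (real k)\<^sup>2 * C ^ 4 * (real N)\<^sup>2 * real (q ^ N)"
proof -
  let ?h = "\<lambda>a. on_sites q N a k h"
  define t where "t a b c d = mat_trace (?h a * (?h b * (?h c * ?h d)))" for a b c d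
  \<comment> \<open>\<open>nb x i\<close> is the site at cyclic offset \<open>i - (k - 1)\<close>
    from \<open>x\<close>, with \<open>N\<close> added to stay within the natural numbers. The
    \<open>2 * k - 1\<close> offsets of modulus less than \<open>k\<close> are those at which two
    blocks can overlap.\<close>
  define nb where "nb x i = (x + (N - (k - 1)) + i) mod N" for x i
  define D where "D = 2 * k - 1"
  define near where "near x y \<longleftrightarrow> (\<exists>i<D. y = nb x i)" for x y
  have sym: "near y x" if "x < N" "y < N" and xy: "near x y" for x y
  proof -
    obtain i where i: "i < D" "y = nb x i" using xy unfolding near_def by blast
    \<comment> \<open>Negating the offset \<open>i - (k - 1)\<close> replaces \<open>i\<close> by
      \<open>2 * (k - 1) - i\<close>.\<close>
    have "nb y (2 * (k - 1) - i) = (x + (N - (k - 1)) + i + (N - (k - 1)) + (2 * (k - 1) - i)) mod N"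
      by (simp add: i nb_def mod_add_left_eq add.assoc)
    also have "x + (N - (k - 1)) + i + (N - (k - 1)) + (2 * (k - 1) - i) = x + 2 * N"
      using i assms(3,4) by (simp add: D_def)
    finally have "nb y (2 * (k - 1) - i) = x" using that by simp
    then show ?thesis using i assms(3) unfolding near_def D_def
      by (intro exI[of _ "2 * (k - 1) - i"]) auto
  qed
  have far: "k \<le> (y + (N - x)) mod N \<and> (y + (N - x)) mod N + k \<le> N"
    if "x < N" "y < N" "\<not> near x y" for x y
  proof -
    \<comment> \<open>\<open>e\<close> is the forward distance from \<open>x\<close> to
      \<open>y\<close> around the ring. If \<open>e < k\<close> then \<open>y\<close> has offset
      \<open>e\<close>, and if \<open>e + k > N\<close> it has offset \<open>e - N\<close>; these
      are the cases \<open>m = 1\<close> and \<open>m = 0\<close> of \<open>nb_eq\<close>.\<close>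
    define e where "e = (y + (N - x)) mod N"
    have e: "e < N" using N_pos by (simp add: e_def)
    have "(x + e) mod N = (x + (y + (N - x))) mod N" by (simp add: e_def mod_add_right_eq)
    also have "x + (y + (N - x)) = y + N" using that by simp
    finally have y: "y = (x + e) mod N" using that by simp
    have nb_eq: "nb x i = y" if "i + N = k - 1 + e + m * N" for i m
    proof -
      have eq: "x + (N - (k - 1)) + i = x + e + m * N" using that assms(4) by simp
      show ?thesis by (simp only: nb_def eq y mod_mult_self1)
    qed
    have "k \<le> e"
    proof (rule ccontr)
      assume "\<not> k \<le> e"
      then have "k - 1 + e < D" using assms(3) by (simp add: D_def)
      moreover have "nb x (k - 1 + e) = y" using nb_eq[of "k - 1 + e" 1] by simp
      ultimately show False using that by (auto simp: near_def)
    qed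
    moreover have "e + k \<le> N"
    proof (rule ccontr)
      assume *: "\<not> e + k \<le> N"
      then have "k - 1 + e - N < D" using e assms(3) by (simp add: D_def)
      moreover have "nb x (k - 1 + e - N) = y" using nb_eq[of "k - 1 + e - N" 0] * by simp
      ultimately show False using that by (auto simp: near_def)
    qed
    ultimately show ?thesis by (simp add: e_def)
  qed
  have t0: "t a b c d = 0" if "a < N" "b < N" "c < N" "d < N" "\<not> (near a b \<or> near a c \<or> near a d)"
    for a b c d
    unfolding t_def
    by (rule mat_trace_four_on_sites_eq_0[OF h assms(4)]) (use that far in auto)
  have trot: "t a b c d = t b c d a" for a b c d
    unfolding t_def by (intro mat_trace_four_rotate on_sites_carrier)
  define S where "S = {(a, b, c, d). a < N \<and> b < N \<and> c < N \<and> d < N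
      \<and> (near a b \<or> near a c \<or> near a d) \<and> (near b c \<or> near b d \<or> near b a)
      \<and> (near c d \<or> near c a \<or> near c b)}"
  have S: "S \<subseteq> {..<N} \<times> {..<N} \<times> {..<N} \<times> {..<N}" by (auto simp: S_def)
  have cardS: "card S \<le> 8 * (N * D)\<^sup>2"
    unfolding S_def near_def by (rule card_quadruples_not_isolated) (use sym in \<open>simp add: near_def\<close>)
  have bound: "cmod (t a b c d) \<le> C ^ 4 * real (q ^ N)" for a b c d
  proof -
    have b1: "abs_sums_le (?h x) C" for x
      by (rule abs_sums_le_on_sites[OF h(1) assms(4) C(1)])
    have "abs_sums_le (?h a * (?h b * (?h c * ?h d))) (C * (C * (C * C)))"
      using C(2)
      by (intro abs_sums_le_mult[of _ "q ^ N" "q ^ N" _ "q ^ N"] b1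
          mult_carrier_mat[of _ "q ^ N" "q ^ N"] on_sites_carrier mult_nonneg_nonneg)
    then have "cmod (t a b c d) \<le> (C * (C * (C * C))) * real (q ^ N)"
      unfolding t_def
      by (intro norm_mat_trace_le mult_carrier_mat[of _ "q ^ N" "q ^ N"] on_sites_carrier)
    then show ?thesis by (simp add: power4_eq_xxxx mult.assoc)
  qed
  have "mat_trace (hamiltonian q N k h * (hamiltonian q N k h * (hamiltonian q N k h * hamiltonian q N k h)))
      = (\<Sum>a<N. \<Sum>b<N. \<Sum>c<N. \<Sum>d<N. t a b c d)"
    unfolding t_def by (rule mat_trace_hamiltonian_pow4)
  also have "\<dots> = (\<Sum>(a, b, c, d)\<in>{..<N} \<times> {..<N} \<times> {..<N} \<times> {..<N}. t a b c d)"
    by (simp add: sum.cartesian_product)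
  also have "\<dots> = (\<Sum>(a, b, c, d)\<in>S. t a b c d)"
  proof (rule sum.mono_neutral_right[OF _ S]; clarify?)
    \<comment> \<open>\<open>t0\<close> treats an isolated first entry; an isolated second or third
      entry is rotated to the front by \<open>trot\<close>.\<close>
    fix a b c d assume "(a, b, c, d) \<notin> S" "a < N" "b < N" "c < N" "d < N"
    then show "t a b c d = 0"
      using t0[of a b c d] t0[of b c d a] t0[of c d a b] trot[of a b c d] trot[of b c d a]
      by (auto simp: S_def)
  qed simp
  also have "cmod \<dots> \<le> (\<Sum>x\<in>S. C ^ 4 * real (q ^ N))"
    by (rule sum_norm_le) (use bound in auto)
  also have "\<dots> = real (card S) * (C ^ 4 * real (q ^ N))" by simp
  also have "\<dots> \<le> (8 * (real N * (2 * real k))\<^sup>2) * (C ^ 4 * real (q ^ N))"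
  proof (rule mult_right_mono)
    have le: "N * D \<le> N * (2 * k)" by (simp add: D_def)
    then have "card S \<le> 8 * (N * (2 * k))\<^sup>2"
      using cardS power_mono[OF le, of 2] by linarith
    then have "real (card S) \<le> real (8 * (N * (2 * k))\<^sup>2)" by (rule of_nat_mono)
    then show "real (card S) \<le> 8 * (real N * (2 * real k))\<^sup>2" by simp
  qed (use C(2) in simp)
  also have "\<dots> = 32 * (real k)\<^sup>2 * C ^ 4 * (real N)\<^sup>2 * real (q ^ N)"
    by (simp add: power_mult_distrib)
  finally show ?thesis .
qed

end

section \<open>Least squares and Taylor polynomials\<close>

lemma cmod_add_squared: "(cmod (z + w))\<^sup>2 = (cmod z)\<^sup>2 + (cmod w)\<^sup>2 + 2 * Re (z * cnj w)"
  unfolding cmod_power2 by (simp add: power2_eq_square algebra_simps)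

text \<open>The hypotheses make the residual orthogonal to the constants and to \<open>x\<close>,
  and Pythagoras gives the inequality. The slope enters through a product, not a quotient, which
  covers the case that all \<open>x j\<close> vanish.\<close>

lemma sum_residual_least_squares:
  fixes A :: "'a \<Rightarrow> complex" and x :: "'a \<Rightarrow> real"
  assumes "(\<Sum>j\<in>J. x j) = 0" "(\<Sum>j\<in>J. A j) = 0"
    and "c * (\<Sum>j\<in>J. of_real ((x j)\<^sup>2)) = (\<Sum>j\<in>J. A j * of_real (x j))"
  shows "(\<Sum>j\<in>J. (cmod (A j - c * of_real (x j)))\<^sup>2)
    \<le> (\<Sum>j\<in>J. (cmod (A j - (c0 + c1 * of_real (x j))))\<^sup>2)"
proof -
  define r where "r j = A j - c * of_real (x j)" for j
  define w where "w j = - c0 + (c - c1) * of_real (x j)" for j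
  have x0: "(\<Sum>j\<in>J. of_real (x j)) = (0 :: complex)"
    using assms(1) by (simp flip: of_real_sum)
  have r0: "(\<Sum>j\<in>J. r j) = 0"
    by (simp add: r_def sum_subtractf assms(2) sum_distrib_left[symmetric] x0)
  have "(\<Sum>j\<in>J. r j * of_real (x j))
      = (\<Sum>j\<in>J. A j * of_real (x j)) - c * (\<Sum>j\<in>J. of_real ((x j)\<^sup>2))"
    by (simp add: r_def sum_subtractf sum_distrib_left power2_eq_square algebra_simps)
  then have rx0: "(\<Sum>j\<in>J. r j * of_real (x j)) = 0" by (simp only: assms(3) diff_self)
  have "(\<Sum>j\<in>J. r j * cnj (w j)) = cnj (- c0) * (\<Sum>j\<in>J. r j) + cnj (c - c1) * (\<Sum>j\<in>J. r j * of_real (x j))"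
    by (simp add: w_def sum_distrib_left sum.distrib[symmetric] algebra_simps)
  then have rw0: "(\<Sum>j\<in>J. r j * cnj (w j)) = 0" by (simp add: r0 rx0)
  have "(\<Sum>j\<in>J. (cmod (A j - (c0 + c1 * of_real (x j))))\<^sup>2) = (\<Sum>j\<in>J. (cmod (r j + w j))\<^sup>2)"
    by (simp add: r_def w_def algebra_simps)
  also have "\<dots> = (\<Sum>j\<in>J. (cmod (r j))\<^sup>2) + (\<Sum>j\<in>J. (cmod (w j))\<^sup>2) + 2 * Re (\<Sum>j\<in>J. r j * cnj (w j))"
    by (simp add: cmod_add_squared sum.distrib sum_distrib_left)
  also have "\<dots> \<ge> (\<Sum>j\<in>J. (cmod (r j))\<^sup>2)" by (simp add: rw0 sum_nonneg)
  finally show ?thesis by (simp add: r_def)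
qed

section \<open>Taylor polynomials with uniformly bounded coefficients\<close>

text \<open>The combination \<open>p x - 2 ^ m * p (x / 2)\<close> has no coefficient of degree \<open>m\<close>, which allows
  an induction on the degree.\<close>

lemma polynomial_coeffs_bounded:
  assumes "\<delta> > 0"
  shows "\<exists>B \<ge> 0. \<forall>c :: nat \<Rightarrow> complex.
    (\<forall>x \<in> {-\<delta>..\<delta>}. cmod (\<Sum>i\<le>m. c i * of_real x ^ i) \<le> A) \<longrightarrow> (\<forall>i\<le>m. cmod (c i) \<le> B)"
proof (induction m arbitrary: A)
  case 0
  show ?case
  proof (intro exI[of _ "\<bar>A\<bar>"] conjI allI impI)
    fix c :: "nat \<Rightarrow> complex" and i :: nat
    assume "\<forall>x \<in> {-\<delta>..\<delta>}. cmod (\<Sum>i\<le>0. c i * of_real x ^ i) \<le> A" and "i \<le> 0"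
    then show "cmod (c i) \<le> \<bar>A\<bar>" using assms by (auto dest!: bspec[of _ _ 0])
  qed simp
next
  case (Suc m)
  let ?M = "Suc m"
  obtain B where B: "B \<ge> 0" and IH: "\<And>c :: nat \<Rightarrow> complex.
      (\<forall>x \<in> {-\<delta>..\<delta>}. cmod (\<Sum>i\<le>m. c i * of_real x ^ i) \<le> A + 2 ^ ?M * A) \<Longrightarrow> (\<forall>i\<le>m. cmod (c i) \<le> B)"
    using Suc[of "A + 2 ^ ?M * A"] by blast
  \<comment> \<open>Once the lower coefficients are bounded by \<open>B\<close>, evaluation at
    \<open>\<delta>\<close> bounds the leading one.\<close>
  define B' where "B' = (\<bar>A\<bar> + (\<Sum>i\<le>m. B * \<delta> ^ i)) / \<delta> ^ ?M"
  show ?case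
  proof (intro exI[of _ "max B B'"] conjI allI impI)
    show "max B B' \<ge> 0" using B by simp
    fix c :: "nat \<Rightarrow> complex" and i :: nat
    assume le: "\<forall>x \<in> {-\<delta>..\<delta>}. cmod (\<Sum>i\<le>?M. c i * of_real x ^ i) \<le> A" and i: "i \<le> ?M"
    define p where "p x = (\<Sum>i\<le>?M. c i * of_real x ^ i)" for x :: real
    \<comment> \<open>The factor is 0 in the top degree and has modulus at least 1 below it, so a
      bound on \<open>c'\<close> passes to the lower coefficients of \<open>c\<close>.\<close>
    define c' where "c' i = c i * (1 - 2 ^ (?M - i))" for i
    have "(\<Sum>i\<le>m. c' i * of_real x ^ i) = p x - 2 ^ ?M * p (x / 2)" for x :: real
    proof -
      have "p x - 2 ^ ?M * p (x / 2) = (\<Sum>i\<le>?M. c i * of_real x ^ i - 2 ^ ?M * (c i * of_real (x / 2) ^ i))"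
        by (simp only: p_def sum_subtractf sum_distrib_left)
      also have "\<dots> = (\<Sum>i\<le>?M. c' i * of_real x ^ i)"
      proof (intro sum.cong refl)
        fix i assume "i \<in> {..?M}"
        then have "(2 :: complex) ^ ?M = 2 ^ (?M - i) * 2 ^ i" by (simp flip: power_add)
        then have "2 ^ ?M * (c i * of_real (x / 2) ^ i) = 2 ^ (?M - i) * (c i * of_real x ^ i)"
          by (simp add: power_divide)
        then show "c i * of_real x ^ i - 2 ^ ?M * (c i * of_real (x / 2) ^ i) = c' i * of_real x ^ i"
          by (simp only: c'_def) (simp add: algebra_simps)
      qed
      finally show ?thesis by (simp add: c'_def)
    qed
    moreover have "cmod (p x - 2 ^ ?M * p (x / 2)) \<le> A + 2 ^ ?M * A" if "x \<in> {-\<delta>..\<delta>}" for x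
    proof -
      have "cmod (p y) \<le> A" if "y \<in> {-\<delta>..\<delta>}" for y using le that unfolding p_def by blast
      then have "cmod (p x) \<le> A" "cmod (p (x / 2)) \<le> A" using that assms by auto
      then have "cmod (p x) + cmod (2 ^ ?M * p (x / 2)) \<le> A + 2 ^ ?M * A"
        by (intro add_mono) (auto simp: norm_mult norm_power)
      then show ?thesis by (rule order_trans[OF norm_triangle_ineq4])
    qed
    ultimately have c': "\<forall>i\<le>m. cmod (c' i) \<le> B" by (intro IH) auto
    have small: "cmod (c i) \<le> B" if "i \<le> m" for i
    proof -
      have "(2 :: real) \<le> 2 ^ (?M - i)" using that power_increasing[of 1 "?M - i" "2 :: real"] by simp
      then have "1 \<le> \<bar>1 - 2 ^ (?M - i) :: real\<bar>" by simp
      moreover have "cmod (1 - 2 ^ (?M - i)) = \<bar>1 - 2 ^ (?M - i) :: real\<bar>"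
        by (subst norm_of_real[where 'a = complex, symmetric]) simp
      ultimately have "cmod (c i) * 1 \<le> cmod (c' i)"
        unfolding c'_def norm_mult by (intro mult_left_mono) auto
      then show ?thesis using c' that by fastforce
    qed
    have "cmod (c ?M) \<le> B'"
    proof -
      have "c ?M * of_real \<delta> ^ ?M = p \<delta> - (\<Sum>i\<le>m. c i * of_real \<delta> ^ i)" by (simp add: p_def)
      then have "cmod (c ?M * of_real \<delta> ^ ?M) \<le> cmod (p \<delta>) + cmod (\<Sum>i\<le>m. c i * of_real \<delta> ^ i)"
        by (simp only: norm_triangle_ineq4)
      also have "cmod (p \<delta>) \<le> A" using le assms by (auto simp: p_def)
      also have "cmod (\<Sum>i\<le>m. c i * of_real \<delta> ^ i) \<le> (\<Sum>i\<le>m. B * \<delta> ^ i)"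
        using small assms by (intro sum_norm_le) (auto simp: norm_mult norm_power intro!: mult_right_mono)
      finally have "cmod (c ?M) * \<delta> ^ ?M \<le> \<bar>A\<bar> + (\<Sum>i\<le>m. B * \<delta> ^ i)"
        using assms by (simp add: norm_mult norm_power)
      then show ?thesis using assms by (simp add: B'_def pos_le_divide_eq)
    qed
    then show "cmod (c i) \<le> max B B'" using small[of i] i by (cases "i = ?M") auto
  qed
qed

text \<open>Every term of degree at least 2, and the remainder of degree \<open>m + 1\<close>,
  contains a factor \<open>x\<^sup>2\<close>; the surplus powers of \<open>x\<close> are at most
  powers of \<open>\<delta>\<close>.\<close>

lemma taylor_affine_bound:
  assumes "1 \<le> m" "0 \<le> K" "\<bar>x\<bar> \<le> \<delta>" and c: "\<And>i. i \<le> m \<Longrightarrow> cmod (c i) \<le> B"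
    and "cmod (y - (\<Sum>i\<le>m. c i * of_real x ^ i)) \<le> K * \<bar>x\<bar> ^ (m + 1)"
  shows "cmod (y - (c 0 + c 1 * of_real x)) \<le> (K * \<delta> ^ (m - 1) + (\<Sum>i\<in>{2..m}. B * \<delta> ^ (i - 2))) * x\<^sup>2"
proof -
  let ?T = "\<Sum>i\<in>{2..m}. c i * of_real x ^ i"
  have pow: "\<bar>x\<bar> ^ i \<le> \<delta> ^ (i - 2) * x\<^sup>2" if "2 \<le> i" for i
  proof -
    have "\<bar>x\<bar> ^ i = \<bar>x\<bar> ^ (i - 2) * \<bar>x\<bar>\<^sup>2"
      using that by (simp only: power_add[symmetric] le_add_diff_inverse2)
    also have "\<dots> \<le> \<delta> ^ (i - 2) * \<bar>x\<bar>\<^sup>2" using assms(3) by (intro mult_right_mono power_mono) auto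
    finally show ?thesis by simp
  qed
  have "{..m} = {0, 1} \<union> {2..m}" using assms(1) by auto
  then have "(\<Sum>i\<le>m. c i * of_real x ^ i) = (\<Sum>i\<in>{0, 1} \<union> {2..m}. c i * of_real x ^ i)" by simp
  also have "\<dots> = (c 0 + c 1 * of_real x) + ?T" by (subst sum.union_disjoint) auto
  finally have "y - (c 0 + c 1 * of_real x) = (y - (\<Sum>i\<le>m. c i * of_real x ^ i)) + ?T" by simp
  then have "cmod (y - (c 0 + c 1 * of_real x)) \<le> cmod (y - (\<Sum>i\<le>m. c i * of_real x ^ i)) + cmod ?T"
    by (simp only: norm_triangle_ineq)
  also have "\<dots> \<le> K * \<delta> ^ (m - 1) * x\<^sup>2 + (\<Sum>i\<in>{2..m}. B * \<delta> ^ (i - 2) * x\<^sup>2)"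
  proof (rule add_mono)
    have "K * \<bar>x\<bar> ^ (m + 1) \<le> K * (\<delta> ^ (m + 1 - 2) * x\<^sup>2)"
      using assms(1,2) by (intro mult_left_mono pow) auto
    then show "cmod (y - (\<Sum>i\<le>m. c i * of_real x ^ i)) \<le> K * \<delta> ^ (m - 1) * x\<^sup>2"
      using assms(5) by (simp add: mult.assoc)
    show "cmod ?T \<le> (\<Sum>i\<in>{2..m}. B * \<delta> ^ (i - 2) * x\<^sup>2)"
    proof (rule sum_norm_le)
      fix i assume i: "i \<in> {2..m}"
      have "cmod (c i) * \<bar>x\<bar> ^ i \<le> B * (\<delta> ^ (i - 2) * x\<^sup>2)"
        using i order_trans[OF norm_ge_zero c[of i]] by (intro mult_mono c pow) auto
      then show "cmod (c i * of_real x ^ i) \<le> B * \<delta> ^ (i - 2) * x\<^sup>2"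
        by (simp add: norm_mult norm_power mult.assoc)
    qed
  qed
  finally show ?thesis by (simp add: distrib_right sum_distrib_right)
qed

text \<open>Beyond \<open>\<delta>\<close> one has
  \<open>1 \<le> x\<^sup>2 / \<delta>\<^sup>2\<close> and
  \<open>\<bar>x\<bar> \<le> x\<^sup>2 / \<delta>\<close>. A crude bound thus takes the quadratic
  form that holds near 0, and one fourth moment controls both ranges.\<close>

lemma affine_bound_tail:
  assumes "0 < \<delta>" "\<delta> < \<bar>x\<bar>" "cmod y \<le> C" "cmod c0 \<le> B" "cmod c1 \<le> B"
  shows "cmod (y - (c0 + c1 * of_real x)) \<le> ((C + B) / \<delta>\<^sup>2 + B / \<delta>) * x\<^sup>2"
proof -
  have x1: "1 \<le> \<bar>x\<bar> / \<delta>" using assms by simp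
  have x2: "\<bar>x\<bar> \<le> x\<^sup>2 / \<delta>"
    using mult_left_mono[OF x1 abs_ge_zero[of x]] by (simp add: power2_eq_square abs_mult_self_eq flip: mult.assoc)
  have x3: "1 \<le> x\<^sup>2 / \<delta>\<^sup>2" using power_mono[OF x1, of 2] by (simp add: power_divide)
  have B: "0 \<le> B" "0 \<le> C" using assms norm_ge_zero order_trans by blast+
  have "cmod (y - (c0 + c1 * of_real x)) \<le> cmod y + (cmod c0 + cmod (c1 * of_real x))"
    by (meson norm_triangle_ineq4 norm_triangle_ineq order_trans add_left_mono)
  also have "\<dots> \<le> (C + B) * 1 + B * \<bar>x\<bar>"
    using assms(3,4) mult_right_mono[OF assms(5) abs_ge_zero[of x]] by (simp add: norm_mult)
  also have "\<dots> \<le> (C + B) * (x\<^sup>2 / \<delta>\<^sup>2) + B * (x\<^sup>2 / \<delta>)"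
    using B by (intro add_mono mult_left_mono x2 x3) auto
  finally show ?thesis by (simp add: algebra_simps)
qed

text \<open>Degree at least 2 ensures that subtracting the identity leaves the leading coefficient
  unchanged. In degree 1 a leading coefficient below 1 would defeat the inequality.\<close>

lemma eventually_poly_ge_self:
  fixes P :: "real poly"
  assumes "degree P \<ge> 2" "lead_coeff P > 0"
  shows "\<forall>\<^sub>F N in sequentially. real N \<le> poly P (real N)"
proof -
  have "lead_coeff ([:0, -1:] + P) = lead_coeff P"
    using assms(1) by (intro lead_coeff_add_le) simp
  then have pos: "lead_coeff ([:0, -1:] + P) > 0" using assms(2) by simp
  from poly_pinfty_gt_lc[OF pos] obtain n where
    n: "\<And>x. x \<ge> n \<Longrightarrow> lead_coeff ([:0, -1:] + P) \<le> poly ([:0, -1:] + P) x" by blast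
  have "\<forall>\<^sub>F N in sequentially. real N \<ge> n"
    using filterlim_real_sequentially by (simp add: filterlim_at_top)
  then show ?thesis
  proof eventually_elim
    case (elim N)
    then show ?case using n[of "real N"] pos by simp
  qed
qed

section \<open>Rate of convergence\<close>

text \<open>On zero spins an operator is a 1 by 1 matrix, so a traceless one is zero and has norm
  0.\<close>

lemma traceless_unit_pos:
  assumes "traceless_unit q k h"
  shows "0 < k"
proof (rule ccontr)
  assume "\<not> 0 < k"
  then have h: "h \<in> carrier_mat 1 1" and "mat_trace h = 0" and n: "op_norm h = 1"
    using assms by (auto simp: traceless_unit_def)
  then have h00: "h $$ (0, 0) = 0" by (simp add: mat_trace_def)
  define S where "S = {v :: complex vec. v \<in> carrier_vec 1 \<and> vnorm v = 1}"
  have v0: "vnorm (h *\<^sub>v v) = 0" if "v \<in> S" for v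
    using that h h00 by (auto simp: S_def vnorm_def scalar_prod_def)
  have "unit_vec 1 0 \<in> S" by (simp add: S_def vnorm_def scalar_prod_def)
  moreover have "(\<lambda>v. vnorm (h *\<^sub>v v)) ` S = (\<lambda>v. 0) ` S" by (intro image_cong refl v0)
  ultimately have "(\<lambda>v. vnorm (h *\<^sub>v v)) ` S = {0}" by auto
  moreover have "op_norm h = Sup ((\<lambda>v. vnorm (h *\<^sub>v v)) ` S)"
    using h by (auto simp: op_norm_def S_def)
  ultimately show False using n by simp
qed

text \<open>Least squares eliminates \<open>c0\<close> and \<open>c1\<close> from the bound.
  Squaring the error by \<open>(a + b)^2 \<le> 2 a^2 + 2 b^2\<close> costs a factor 2, which with
  the 32 of the fourth moment gives 64.\<close>

lemma (in spin_chain) mean_square_deviation_le: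
  assumes h: "h \<in> carrier_mat (q ^ k) (q ^ k)" "mat_trace h = 0" and k: "0 < k" "k \<le> N"
    and a: "a \<in> carrier_mat (q ^ l) (q ^ l)" "mat_trace a = 0" "l \<le> N"
    and C: "abs_sums_le h C" "0 \<le> C"
    and basis: "ti_eigenbasis q N (hamiltonian q N k h) \<psi> E"
    and c: "c = mat_trace (hamiltonian q N k h * on_sites q N s l a)
      / mat_trace (hamiltonian q N k h * on_first q N k h)"
    and approx: "\<And>j. j < q ^ N \<Longrightarrow>
      cmod (expval (on_sites q N s l a) (\<psi> j) - (c0 + c1 * of_real (E j / real N)))
        \<le> K * (E j / real N)\<^sup>2 + 1 / real N"
  shows "(\<Sum>j<q ^ N. (cmod (expval (on_sites q N s l a) (\<psi> j) - c * of_real (E j / real N)))\<^sup>2)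
      / real (q ^ N) \<le> (64 * K\<^sup>2 * (real k)\<^sup>2 * C ^ 4 + 2) / (real N)\<^sup>2"
proof -
  let ?n = "q ^ N"
  define H where "H = hamiltonian q N k h"
  define A where "A = on_sites q N s l a"
  define x where "x j = E j / real N" for j
  have H: "H \<in> carrier_mat ?n ?n" and A: "A \<in> carrier_mat ?n ?n" by (simp_all add: H_def A_def)
  have HH: "H * H \<in> carrier_mat ?n ?n" "H * H * H \<in> carrier_mat ?n ?n"
    using H by (auto intro!: mult_carrier_mat[of _ ?n ?n])
  have \<psi>: "\<psi> j \<in> carrier_vec ?n" and eig: "H *\<^sub>v \<psi> j = of_real (E j) \<cdot>\<^sub>v \<psi> j"
    and one: "\<psi> j \<bullet>c \<psi> j = 1" if "j < ?n" for j
    using basis that by (auto simp: ti_eigenbasis_def H_def)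
  have tr: "(\<Sum>j<?n. expval X (\<psi> j)) = mat_trace X" if "X \<in> carrier_mat ?n ?n" for X
    using basis by (intro sum_expval_orthonormal that) (auto simp: ti_eigenbasis_def)
  have N0: "real N \<noteq> 0" using N_pos by simp
  note em = expval_mult_eigenvector[OF _ H \<psi> eig]
  have E1: "expval H (\<psi> j) = of_real (E j)" if "j < ?n" for j
    using eig[OF that] one[OF that] \<psi>[OF that] by (simp add: expval_def)
  have E2: "expval (H * H) (\<psi> j) = of_real ((E j)\<^sup>2)" if "j < ?n" for j
    by (simp add: em[OF H that that] E1[OF that] power2_eq_square)
  have E4: "expval (H * H * H * H) (\<psi> j) = of_real ((E j) ^ 4)" if "j < ?n" for j
    by (simp add: em[OF HH(2) that that] em[OF HH(1) that that] E2[OF that] power2_eq_square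
        power4_eq_xxxx)
  have sE: "(\<Sum>j<?n. E j) = 0"
  proof -
    have "(\<Sum>j<?n. complex_of_real (E j)) = mat_trace H" using tr[OF H] E1 by simp
    also have "\<dots> = 0" using mat_trace_hamiltonian[OF h(1) k(2) h(2)] by (simp add: H_def)
    finally show ?thesis by (metis of_real_eq_0_iff of_real_sum)
  qed
  have sA: "(\<Sum>j<?n. expval A (\<psi> j)) = 0"
    using tr[OF A] mat_trace_on_sites[OF a(1,3)] a(2) by (simp add: A_def)
  have sAE: "(\<Sum>j<?n. expval A (\<psi> j) * of_real (E j)) = mat_trace (H * A)"
    using tr[OF mult_carrier_mat[OF A H]] em[OF A] mat_trace_cyclic[OF H A] by (simp add: mult.commute)
  have sE2: "(\<Sum>j<?n. of_real ((E j)\<^sup>2)) = of_nat N * mat_trace (H * on_first q N k h)"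
    using tr[OF HH(1)] E2 mat_trace_hamiltonian_square[of k h] by (simp add: H_def)
  have c': "c * (of_nat N * mat_trace (H * on_first q N k h)) = of_nat N * mat_trace (H * A)"
  proof (cases "mat_trace (H * on_first q N k h) = 0")
    case True
    then have "(\<Sum>j<?n. complex_of_real ((E j)\<^sup>2)) = 0" using sE2 by simp
    then have "(\<Sum>j<?n. (E j)\<^sup>2) = 0" by (metis of_real_eq_0_iff of_real_sum)
    then have "E j = 0" if "j < ?n" for j using that by (simp add: sum_nonneg_eq_0_iff)
    then have "mat_trace (H * A) = 0" using sAE by simp
    then show ?thesis using True by simp
  next
    case False
    then show ?thesis by (simp add: c H_def A_def)
  qed
  have "(\<Sum>j<?n. (cmod (expval A (\<psi> j) - c * of_real (x j)))\<^sup>2)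
      \<le> (\<Sum>j<?n. (cmod (expval A (\<psi> j) - (c0 + c1 * of_real (x j))))\<^sup>2)"
  proof (rule sum_residual_least_squares)
    show "(\<Sum>j<?n. x j) = 0" using sE by (simp add: x_def flip: sum_divide_distrib)
    show "(\<Sum>j<?n. expval A (\<psi> j)) = 0" by (rule sA)
    have "c * (\<Sum>j<?n. of_real ((x j)\<^sup>2)) = c * (\<Sum>j<?n. of_real ((E j)\<^sup>2)) / (of_nat N)\<^sup>2"
      by (simp add: x_def power_divide flip: sum_divide_distrib)
    also have "\<dots> = (\<Sum>j<?n. expval A (\<psi> j) * of_real (E j)) / of_nat N"
      unfolding sE2 c' sAE using N0 by (simp add: power2_eq_square)
    also have "\<dots> = (\<Sum>j<?n. expval A (\<psi> j) * of_real (x j))"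
      by (simp add: x_def flip: sum_divide_distrib)
    finally show "c * (\<Sum>j<?n. of_real ((x j)\<^sup>2)) = (\<Sum>j<?n. expval A (\<psi> j) * of_real (x j))" .
  qed
  also have "\<dots> \<le> (\<Sum>j<?n. 2 * K\<^sup>2 * (x j) ^ 4 + 2 / (real N)\<^sup>2)"
  proof (rule sum_mono)
    fix j assume "j \<in> {..<?n}"
    then have "cmod (expval A (\<psi> j) - (c0 + c1 * of_real (x j))) \<le> K * (x j)\<^sup>2 + 1 / real N"
      using approx[of j] by (simp add: A_def x_def)
    then have "(cmod (expval A (\<psi> j) - (c0 + c1 * of_real (x j))))\<^sup>2 \<le> (K * (x j)\<^sup>2 + 1 / real N)\<^sup>2"
      by (rule power_mono) simp
    also have "\<dots> \<le> 2 * (K * (x j)\<^sup>2)\<^sup>2 + 2 * (1 / real N)\<^sup>2"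
      using sum_squares_bound[of "K * (x j)\<^sup>2" "1 / real N"]
      by (simp only: power2_sum)
    also have "\<dots> = 2 * K\<^sup>2 * (x j) ^ 4 + 2 / (real N)\<^sup>2"
      by (simp add: power_mult_distrib power_divide flip: power_mult)
    finally show "(cmod (expval A (\<psi> j) - (c0 + c1 * of_real (x j))))\<^sup>2 \<le> 2 * K\<^sup>2 * (x j) ^ 4 + 2 / (real N)\<^sup>2" .
  qed
  also have "\<dots> = 2 * K\<^sup>2 * (\<Sum>j<?n. (E j) ^ 4) / (real N) ^ 4 + real ?n * (2 / (real N)\<^sup>2)"
    by (simp add: sum.distrib x_def power_divide sum_distrib_left sum_divide_distrib)
  also have "\<dots> \<le> 2 * K\<^sup>2 * (32 * (real k)\<^sup>2 * C ^ 4 * (real N)\<^sup>2 * real ?n) / (real N) ^ 4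
      + real ?n * (2 / (real N)\<^sup>2)"
  proof (intro add_right_mono divide_right_mono mult_left_mono)
    have "(\<Sum>j<?n. complex_of_real ((E j) ^ 4)) = mat_trace (H * H * H * H)"
      using tr[OF mult_carrier_mat[OF HH(2) H]] E4 by simp
    also have "H * H * H * H = H * (H * (H * H))"
      by (simp only: assoc_mult_mat[OF HH(1) H H] assoc_mult_mat[OF H H HH(1)])
    finally have "complex_of_real (\<Sum>j<?n. (E j) ^ 4) = mat_trace (H * (H * (H * H)))" by simp
    then have "cmod (mat_trace (H * (H * (H * H)))) = \<bar>\<Sum>j<?n. (E j) ^ 4\<bar>"
      by (metis norm_of_real)
    then show "(\<Sum>j<?n. (E j) ^ 4) \<le> 32 * (real k)\<^sup>2 * C ^ 4 * (real N)\<^sup>2 * real ?n"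
      using norm_mat_trace_hamiltonian_pow4_le[OF h k C] unfolding H_def by linarith
  qed simp_all
  also have "\<dots> = (64 * K\<^sup>2 * (real k)\<^sup>2 * C ^ 4 + 2) / (real N)\<^sup>2 * real ?n"
    using N0 by (simp add: field_simps power4_eq_xxxx power2_eq_square)
  finally show ?thesis
    using q_pos by (simp add: A_def x_def pos_divide_le_eq)
qed

text \<open>Since \<open>R / real n\<close> decreases in \<open>n\<close>, its value at
  \<open>N\<close> bounds the whole tail. This also makes the set bounded above, without which the
  real supremum could not be compared with its members.\<close>

lemma sup_conv_rate_bigo:
  assumes "\<forall>\<^sub>F N in sequentially. conv_rate q \<psi> E A f N \<le> R / real N" and "0 \<le> R"
  shows "(\<lambda>N. sup_conv_rate q \<psi> E A f N) \<in> O(\<lambda>N. 1 / real N)"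
proof -
  obtain N0 where N0: "\<And>n. n \<ge> N0 \<Longrightarrow> conv_rate q \<psi> E A f n \<le> R / real n"
    using assms(1) by (auto simp: eventually_sequentially)
  have "norm (sup_conv_rate q \<psi> E A f N) \<le> R * norm (1 / real N)" if N: "N \<ge> max 1 N0" for N
  proof -
    have le: "conv_rate q \<psi> E A f n \<le> R / real N" if "n \<in> {N..}" for n
    proof -
      have "R / real n \<le> R / real N" using that N assms(2) by (intro divide_left_mono) auto
      then show ?thesis using N0[of n] that N by simp
    qed
    have "0 \<le> conv_rate q \<psi> E A f N" by (simp add: conv_rate_def sum_nonneg)
    also have "\<dots> \<le> sup_conv_rate q \<psi> E A f N"
      unfolding sup_conv_rate_def by (intro cSUP_upper bdd_aboveI2[OF le]) auto
    finally have "0 \<le> sup_conv_rate q \<psi> E A f N" .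
    moreover have "sup_conv_rate q \<psi> E A f N \<le> R / real N"
      unfolding sup_conv_rate_def using le by (intro cSUP_least) auto
    ultimately show ?thesis by simp
  qed
  then show ?thesis
    by (intro bigoI[of _ R] eventually_mono[OF eventually_ge_at_top[of "max 1 N0"]])
qed

text \<open>The point is uniformity: \<open>R\<close> is assembled from \<open>k\<close>,
  \<open>\<delta>\<close>, \<open>K\<close>, \<open>m\<close> and the absolute sums of
  \<open>h\<close> and \<open>a\<close>, all independent of \<open>N\<close>.\<close>

lemma conv_rate_extensive_ratio_le:
  assumes q: "2 \<le> q" and h: "h \<in> carrier_mat (q ^ k) (q ^ k)" "mat_trace h = 0" "0 < k"
    and "\<epsilon> > 0" and basis: "\<forall>\<^sub>F N in sequentially. ti_eigenbasis q N (hamiltonian q N k h) (\<psi> N) (E N)"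
    and eth: "eth_middle 2 \<epsilon> q \<psi> E" and ta: "traceless_unit q l a"
    and ratio: "\<forall>\<^sub>F N in sequentially. c = mat_trace (hamiltonian q N k h * on_sites q N s l a)
      / mat_trace (hamiltonian q N k h * on_first q N k h)"
  obtains R where "0 \<le> R"
    "\<forall>\<^sub>F N in sequentially. conv_rate q \<psi> E (\<lambda>n. on_sites q n s l a) (\<lambda>x. c * of_real x) N \<le> R / real N"
proof -
  have a: "a \<in> carrier_mat (q ^ l) (q ^ l)" "mat_trace a = 0" using ta by (auto simp: traceless_unit_def)
  obtain Ch where Ch: "0 \<le> Ch" "abs_sums_le h Ch" by (rule abs_sums_le_exists)
  obtain Ca where Ca: "0 \<le> Ca" "abs_sums_le a Ca" by (rule abs_sums_le_exists)
  obtain g :: "nat \<Rightarrow> real \<Rightarrow> complex" and P :: "real poly" and m :: nat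
    and co :: "nat \<Rightarrow> nat \<Rightarrow> complex" and K \<delta> :: real
    where P: "2 \<le> degree P" "0 < lead_coeff P" and m: "1 \<le> m" and \<delta>: "0 < \<delta>" "\<delta> \<le> \<epsilon>"
      and ev: "\<forall>\<^sub>F N in sequentially.
             (\<forall>x \<in> {-\<epsilon>..\<epsilon>}. cmod (g N x) \<le> 1) \<and>
             (\<forall>x \<in> {-\<delta>..\<delta>}.
                cmod (g N x - (\<Sum>i\<le>m. co N i * of_real x ^ i)) \<le> K * \<bar>x\<bar> ^ (m + 1)) \<and>
             (\<forall>j < q ^ N. \<bar>E N j\<bar> \<le> real N * \<epsilon> \<longrightarrow>
                cmod (expval (on_sites q N s l a) (\<psi> N j) - g N (E N j / real N))
                  \<le> 1 / poly P (real N))"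
    using eth[unfolded eth_middle_def, rule_format, OF ta, of s] by blast
  \<comment> \<open>On the interval of radius \<open>\<delta>\<close> each Taylor polynomial differs
    from \<open>g N\<close> by at most the remainder, whence the bound
    \<open>1 + \<bar>K\<bar> * \<delta> ^ (m + 1)\<close>. The modulus is taken because
    \<open>K\<close> comes without a sign.\<close>
  obtain B where B: "0 \<le> B" and coeffs: "\<And>c :: nat \<Rightarrow> complex.
      (\<forall>x \<in> {-\<delta>..\<delta>}. cmod (\<Sum>i\<le>m. c i * of_real x ^ i) \<le> 1 + \<bar>K\<bar> * \<delta> ^ (m + 1))
      \<Longrightarrow> (\<forall>i\<le>m. cmod (c i) \<le> B)"
    using polynomial_coeffs_bounded[OF \<delta>(1), of m "1 + \<bar>K\<bar> * \<delta> ^ (m + 1)"] by blast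
  \<comment> \<open>\<open>K1\<close> serves the energies with
    \<open>\<bar>x\<bar> \<le> \<delta>\<close>, \<open>K2\<close> the others; the sum covers
    both.\<close>
  define K1 where "K1 = \<bar>K\<bar> * \<delta> ^ (m - 1) + (\<Sum>i\<in>{2..m}. B * \<delta> ^ (i - 2))"
  define K2 where "K2 = (Ca + B) / \<delta>\<^sup>2 + B / \<delta>"
  have K12: "0 \<le> K1" "0 \<le> K2"
    using \<delta> B Ca by (auto simp: K1_def K2_def intro!: add_nonneg_nonneg sum_nonneg)
  define R where "R = sqrt (64 * (K1 + K2)\<^sup>2 * (real k)\<^sup>2 * Ch ^ 4 + 2)"
  have "\<forall>\<^sub>F N in sequentially. conv_rate q \<psi> E (\<lambda>n. on_sites q n s l a) (\<lambda>x. c * of_real x) N \<le> R / real N"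
    using ev ratio basis eventually_poly_ge_self[OF P] eventually_ge_at_top[of "s + k + l + 1"]
  proof eventually_elim
    case (elim N)
    interpret spin_chain q N using q elim(5) by unfold_locales auto
    have g1: "\<And>x. x \<in> {-\<epsilon>..\<epsilon>} \<Longrightarrow> cmod (g N x) \<le> 1"
      and g2: "\<And>x. x \<in> {-\<delta>..\<delta>} \<Longrightarrow>
        cmod (g N x - (\<Sum>i\<le>m. co N i * of_real x ^ i)) \<le> K * \<bar>x\<bar> ^ (m + 1)"
      and g3: "\<And>j. j < q ^ N \<Longrightarrow> \<bar>E N j\<bar> \<le> real N * \<epsilon> \<Longrightarrow>
        cmod (expval (on_sites q N s l a) (\<psi> N j) - g N (E N j / real N)) \<le> 1 / poly P (real N)"
      using elim(1) by blast+
    have g2': "cmod (g N x - (\<Sum>i\<le>m. co N i * of_real x ^ i)) \<le> \<bar>K\<bar> * \<bar>x\<bar> ^ (m + 1)"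
      if "x \<in> {-\<delta>..\<delta>}" for x
      by (rule order_trans[OF g2[OF that]]) (simp add: mult_right_mono)
    have co: "\<And>i. i \<le> m \<Longrightarrow> cmod (co N i) \<le> B"
    proof -
      have "cmod (\<Sum>i\<le>m. co N i * of_real x ^ i) \<le> 1 + \<bar>K\<bar> * \<delta> ^ (m + 1)" if x: "x \<in> {-\<delta>..\<delta>}" for x
      proof -
        have "\<bar>x\<bar> ^ (m + 1) \<le> \<delta> ^ (m + 1)" using x by (intro power_mono) auto
        then have "\<bar>K\<bar> * \<bar>x\<bar> ^ (m + 1) \<le> \<bar>K\<bar> * \<delta> ^ (m + 1)" by (intro mult_left_mono) auto
        then show ?thesis
          using g1[of x] g2'[OF x] x \<delta>
            norm_triangle_ineq2[of "\<Sum>i\<le>m. co N i * of_real x ^ i" "g N x"]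
          by (simp add: norm_minus_commute)
      qed
      then show "\<And>i. i \<le> m \<Longrightarrow> cmod (co N i) \<le> B" using coeffs[of "co N"] by blast
    qed
    have approx: "cmod (expval (on_sites q N s l a) (\<psi> N j) - (co N 0 + co N 1 * of_real (E N j / real N)))
        \<le> (K1 + K2) * (E N j / real N)\<^sup>2 + 1 / real N" if j: "j < q ^ N" for j
    proof -
      let ?x = "E N j / real N" and ?A = "expval (on_sites q N s l a) (\<psi> N j)"
      have xx: "K1 * ?x\<^sup>2 \<le> (K1 + K2) * ?x\<^sup>2" "K2 * ?x\<^sup>2 \<le> (K1 + K2) * ?x\<^sup>2"
        using K12 by (auto intro!: mult_right_mono)
      show ?thesis
      proof (cases "\<bar>?x\<bar> \<le> \<delta>")
        case True
        then have "\<bar>E N j\<bar> \<le> \<delta> * real N" using N_pos by (simp add: abs_divide pos_divide_le_eq)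
        also have "\<dots> \<le> real N * \<epsilon>" using \<delta> by (simp add: mult.commute[of "real N"] mult_right_mono)
        finally have "cmod (?A - g N ?x) \<le> 1 / poly P (real N)" by (rule g3[OF j])
        also have "\<dots> \<le> 1 / real N" using elim(4) N_pos by (intro divide_left_mono) auto
        finally have 1: "cmod (?A - g N ?x) \<le> 1 / real N" .
        have xin: "?x \<in> {-\<delta>..\<delta>}"
          using abs_le_D1[OF True] abs_le_D2[OF True] by (intro iffD2[OF atLeastAtMost_iff] conjI) linarith+
        have 2: "cmod (g N ?x - (co N 0 + co N 1 * of_real ?x)) \<le> K1 * ?x\<^sup>2"
          unfolding K1_def
          by (rule taylor_affine_bound[OF m _ True co g2'[OF xin]]) auto
        have "?A - (co N 0 + co N 1 * of_real ?x)
            = (?A - g N ?x) + (g N ?x - (co N 0 + co N 1 * of_real ?x))"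
          by (simp only: add_diff_eq diff_add_cancel)
        then have "cmod (?A - (co N 0 + co N 1 * of_real ?x))
            \<le> cmod (?A - g N ?x) + cmod (g N ?x - (co N 0 + co N 1 * of_real ?x))"
          by (simp only: norm_triangle_ineq)
        then show ?thesis using 1 2 xx(1) by linarith
      next
        case False
        \<comment> \<open>The Schur test bounds \<open>?A\<close> independently of \<open>N\<close>,
          as \<open>affine_bound_tail\<close> requires.\<close>
        have "cmod ?A \<le> Ca"
          using elim(3,5) j
          by (intro norm_expval_le[OF on_sites_carrier abs_sums_le_on_sites[OF a(1) _ Ca(2)]])
            (auto simp: ti_eigenbasis_def)
        then have "cmod (?A - (co N 0 + co N 1 * of_real ?x)) \<le> K2 * ?x\<^sup>2"
          unfolding K2_def using False m
          by (intro affine_bound_tail[OF \<delta>(1)] co) auto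
        moreover have "0 \<le> 1 / real N" by simp
        ultimately show ?thesis using xx by linarith
      qed
    qed
    have "(\<Sum>j<q ^ N. (cmod (expval (on_sites q N s l a) (\<psi> N j) - c * of_real (E N j / real N)))\<^sup>2)
        / real (q ^ N) \<le> (64 * (K1 + K2)\<^sup>2 * (real k)\<^sup>2 * Ch ^ 4 + 2) / (real N)\<^sup>2"
      using elim(5)
      by (intro mean_square_deviation_le[OF h _ a _ Ch(2,1) elim(3,2) approx]) auto
    then have "conv_rate q \<psi> E (\<lambda>n. on_sites q n s l a) (\<lambda>x. c * of_real x) N
        \<le> sqrt ((64 * (K1 + K2)\<^sup>2 * (real k)\<^sup>2 * Ch ^ 4 + 2) / (real N)\<^sup>2)"
      unfolding conv_rate_def by (rule real_sqrt_le_mono)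
    then show ?case by (simp add: R_def real_sqrt_divide)
  qed
  moreover have "0 \<le> R" using Ch(1) by (simp add: R_def)
  ultimately show thesis using that by blast
qed

theorem theorem2:
  shows "\<exists>p :: nat. \<forall>(q :: nat) (k :: nat) (h :: complex mat) (\<epsilon> :: real)
           (\<psi> :: nat \<Rightarrow> nat \<Rightarrow> complex vec) (E :: nat \<Rightarrow> nat \<Rightarrow> real).
      q \<ge> 2 \<and> traceless_unit q k h \<and> mat_adjoint h = h \<and> \<epsilon> > 0 \<and>
      (\<forall>\<^sub>F N in sequentially. ti_eigenbasis q N (hamiltonian q N k h) (\<psi> N) (E N)) \<and>
      eth_middle p \<epsilon> q \<psi> E \<longrightarrow>
      (\<forall>s l a. traceless_unit q l a \<longrightarrow>
         (\<exists>f :: real \<Rightarrow> complex.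
            (\<forall>\<^sub>F N in sequentially. \<forall>x.
               f x = mat_trace (hamiltonian q N k h * on_sites q N s l a)
                       / mat_trace (hamiltonian q N k h * on_first q N k h) * of_real x) \<and>
            (\<lambda>N. sup_conv_rate q \<psi> E (\<lambda>n. on_sites q n s l a) f N) \<in> O(\<lambda>N. 1 / real N)))"
\<comment> \<open>Degree 2 suffices for \<open>real N \<le> poly P (real N)\<close> eventually, so
  the thermalization error is at most 1/N.\<close>
proof (intro exI[of _ 2] allI impI, elim conjE)
  fix q k s l :: nat and h a :: "complex mat" and \<epsilon> :: real
    and \<psi> :: "nat \<Rightarrow> nat \<Rightarrow> complex vec" and E :: "nat \<Rightarrow> nat \<Rightarrow> real"
  assume q: "2 \<le> q" and th: "traceless_unit q k h" and \<epsilon>: "0 < \<epsilon>"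
    and basis: "\<forall>\<^sub>F N in sequentially. ti_eigenbasis q N (hamiltonian q N k h) (\<psi> N) (E N)"
    and eth: "eth_middle 2 \<epsilon> q \<psi> E" and ta: "traceless_unit q l a"
  have h: "h \<in> carrier_mat (q ^ k) (q ^ k)" "mat_trace h = 0" "0 < k"
    using th traceless_unit_pos by (auto simp: traceless_unit_def)
  have a: "a \<in> carrier_mat (q ^ l) (q ^ l)" "mat_trace a = 0"
    using ta by (auto simp: traceless_unit_def)
  have q0: "0 < q" using q by simp
  \<comment> \<open>\<open>u\<close> and \<open>v\<close> are the values of tr (HA) / d and tr (Hh)
    / d for all large \<open>N\<close>. For \<open>v = 0\<close> both quotients in
    \<open>ratio\<close> are 0 by convention.\<close>
  obtain u where u: "\<And>N s. k + l \<le> N \<Longrightarrow>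
      mat_trace (hamiltonian q N k h * on_sites q N s l a) = u * of_nat (q ^ N)"
    using mat_trace_hamiltonian_on_sites_extensive[OF h(1) a q0 h(3)] by blast
  obtain v where v: "\<And>N s. k + k \<le> N \<Longrightarrow>
      mat_trace (hamiltonian q N k h * on_sites q N s k h) = v * of_nat (q ^ N)"
    using mat_trace_hamiltonian_on_sites_extensive[OF h(1,1,2) q0 h(3)] by blast
  have ratio: "\<forall>\<^sub>F N in sequentially. u / v = mat_trace (hamiltonian q N k h * on_sites q N s l a)
      / mat_trace (hamiltonian q N k h * on_first q N k h)"
    using eventually_ge_at_top[of "k + k + l"]
  proof eventually_elim
    case (elim N)
    interpret spin_chain q N using q0 h(3) elim by unfold_locales auto
    have "mat_trace (hamiltonian q N k h * on_first q N k h) = v * of_nat (q ^ N)"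
      using v[of N 0] elim by (simp add: on_sites_0)
    moreover have "mat_trace (hamiltonian q N k h * on_sites q N s l a) = u * of_nat (q ^ N)"
      using elim by (intro u) simp
    moreover have "(of_nat (q ^ N) :: complex) \<noteq> 0" using q0 by simp
    ultimately show ?case by (simp del: of_nat_power)
  qed
  obtain R where "0 \<le> R" "\<forall>\<^sub>F N in sequentially.
      conv_rate q \<psi> E (\<lambda>n. on_sites q n s l a) (\<lambda>x. u / v * of_real x) N \<le> R / real N"
    by (rule conv_rate_extensive_ratio_le[OF q h \<epsilon> basis eth ta ratio])
  then have "(\<lambda>N. sup_conv_rate q \<psi> E (\<lambda>n. on_sites q n s l a) (\<lambda>x. u / v * of_real x) N)
      \<in> O(\<lambda>N. 1 / real N)"
    by (intro sup_conv_rate_bigo)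
  moreover have "\<forall>\<^sub>F N in sequentially. \<forall>x. u / v * complex_of_real x
      = mat_trace (hamiltonian q N k h * on_sites q N s l a)
        / mat_trace (hamiltonian q N k h * on_first q N k h) * of_real x"
    using ratio by eventually_elim simp
  ultimately show "\<exists>f :: real \<Rightarrow> complex.
      (\<forall>\<^sub>F N in sequentially. \<forall>x.
         f x = mat_trace (hamiltonian q N k h * on_sites q N s l a)
                 / mat_trace (hamiltonian q N k h * on_first q N k h) * of_real x) \<and>
      (\<lambda>N. sup_conv_rate q \<psi> E (\<lambda>n. on_sites q n s l a) f N) \<in> O(\<lambda>N. 1 / real N)"
    by (intro exI[of _ "\<lambda>x. u / v * of_real x"] conjI)
qed

end
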